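(* Assume that the quiver datum $(\mathbf{V},\mathbf{p})$ is feasible. Then for each $\varepsilon>0$ there exists a tuple of matrices $\mathbf{V}'=(V_a')_a$ equivalent to $\mathbf{V}$ such that $$\sum_{j=1}^m p_j\sum_{a\in\mathbf{A}_{ij}}(V_a')^TV_a'=\mathrm{id}_{\mathbb{R}^{d_i}}\quad\text{for each } i\in[k]$$ and $$\Big\|\sum_{i=1}^k\sum_{a\in\mathbf{A}_{ij}}V_a'(V_a')^T-\mathrm{id}_{\mathbb{R}^{n_j}}\Big\|<\varepsilon\quad\text{for each } j\in[m].$$
   Context: Notation: $[r]=\{1,\dots,r\}$; $\mathsf{PD}_{r}$ is the set of real symmetric positive definite $r\times r$ matrices; $\|\cdot\|$ is any fixed norm on matrices. Let $k,m$ be positive integers, $(d_1,\dots,d_k)$ and $(n_1,\dots,n_m)$ tuples of positive integers, and $\mathbf{p}=(p_1,\dots,p_m)$ a tuple of positive reals with $\sum_{i\in[k]}d_i=\sum_{j\in[m]}p_jn_j$. For each $(i,j)\in[k]\times[m]$ let $\mathbf{A}_{ij}$ be a finite index set (the sets being pairwise disjoint), and let $\mathbf{V}=(V_a\in\mathbb{R}^{n_j\times d_i}: a\in\mathbf{A}_{ij},\,i\in[k],\,j\in[m])$. The pair $(\mathbf{V},\mathbf{p})$ is called a quiver datum. Its capacity is $$\mathrm{Cap}(\mathbf{V},\mathbf{p})=\inf_{(Y_j\in\mathsf{PD}_{n_j})_{j\in[m]}}\frac{\prod_{i=1}^k\det\big(\sum_{j=1}^m p_j\sum_{a\in\mathbf{A}_{ij}}V_a^TY_jV_a\big)}{\prod_{j=1}^m(\det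 Y_j)^{p_j}}.$$ $(\mathbf{V},\mathbf{p})$ is feasible if $\mathrm{Cap}(\mathbf{V},\mathbf{p})>0$. Two tuples $\mathbf{V},\mathbf{V}'$ of the same shape are equivalent if there are invertible matrices $(M_i\in\mathbb{R}^{d_i\times d_i})_{i\in[k]}$ and $(N_j\in\mathbb{R}^{n_j\times n_j})_{j\in[m]}$ with $V_a'=N_jV_aM_i^{-1}$ for all $a\in\mathbf{A}_{ij}$, $i\in[k]$, $j\in[m]$. *)

theory Defs
  imports Complex_Main "HOL-Library.Disjoint_Sets" "Jordan_Normal_Form.Determinant"
begin

text \<open>The matrix analogue of \<^const>\<open>finsum_vec\<close>. The size is explicit because the empty sum
  is the zero matrix of that size.\<close>

definition finsum_mat :: "nat \<Rightarrow> nat \<Rightarrow> ('c \<Rightarrow> real mat) \<Rightarrow> 'c set \<Rightarrow> real mat" where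
  "finsum_mat nr nc = finprod (monoid_mat TYPE(real) nr nc)"

lemma index_finsum_mat:
  assumes "finite S" "\<And>x. x \<in> S \<Longrightarrow> f x \<in> carrier_mat nr nc"
  shows "finsum_mat nr nc f S \<in> carrier_mat nr nc \<and>
    (\<forall>r<nr. \<forall>c<nc. finsum_mat nr nc f S $$ (r, c) = (\<Sum>x\<in>S. f x $$ (r, c)))"
  using assms
proof (induction S rule: finite_induct)
  case empty
  interpret comm_monoid "monoid_mat TYPE(real) nr nc" by (rule comm_monoid_mat)
  show ?case unfolding finsum_mat_def finprod_empty by (simp add: monoid_mat_def)
next
  case (insert x S)
  interpret comm_monoid "monoid_mat TYPE(real) nr nc" by (rule comm_monoid_mat)
  have "finsum_mat nr nc f (insert x S) = f x + finsum_mat nr nc f S"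
    unfolding finsum_mat_def
    by (subst finprod_insert) (use insert in \<open>auto simp: monoid_mat_def\<close>)
  then show ?case using insert by auto
qed

definition pos_def_mats :: "nat \<Rightarrow> real mat set" where
  "pos_def_mats r = {Y \<in> carrier_mat r r. transpose_mat Y = Y \<and>
     (\<forall>v \<in> carrier_vec r. v \<noteq> 0\<^sub>v r \<longrightarrow> v \<bullet> (Y *\<^sub>v v) > 0)}"

definition matrix_norm_on :: "nat \<Rightarrow> (real mat \<Rightarrow> real) \<Rightarrow> bool" where
  "matrix_norm_on r nrm \<longleftrightarrow>
     (\<forall>B \<in> carrier_mat r r. 0 \<le> nrm B \<and> (nrm B = 0 \<longleftrightarrow> B = 0\<^sub>m r r)) \<and>
     (\<forall>c. \<forall>B \<in> carrier_mat r r. nrm (c \<cdot>\<^sub>m B) = \<bar>c\<bar> * nrm B) \<and>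
     (\<forall>B \<in> carrier_mat r r. \<forall>C \<in> carrier_mat r r. nrm (B + C) \<le> nrm B + nrm C)"

text \<open>The index ranges are \<open>{1..k}\<close> and \<open>{1..m}\<close>; values of \<open>d\<close>, \<open>n\<close>, \<open>p\<close>, \<open>A\<close> at indices
  outside these ranges, and of \<open>V\<close> outside the sets \<open>A i j\<close>, are irrelevant.\<close>

definition quiver_datum ::
  "nat \<Rightarrow> nat \<Rightarrow> (nat \<Rightarrow> nat) \<Rightarrow> (nat \<Rightarrow> nat) \<Rightarrow> (nat \<Rightarrow> real) \<Rightarrow> (nat \<Rightarrow> nat \<Rightarrow> 'a set) \<Rightarrow>
     ('a \<Rightarrow> real mat) \<Rightarrow> bool" where
  "quiver_datum k m d n p A V \<longleftrightarrow>
     k > 0 \<and> m > 0 \<and>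
     (\<forall>i\<in>{1..k}. d i > 0) \<and>
     (\<forall>j\<in>{1..m}. n j > 0) \<and>
     (\<forall>j\<in>{1..m}. p j > 0) \<and>
     (\<Sum>i\<in>{1..k}. real (d i)) = (\<Sum>j\<in>{1..m}. p j * real (n j)) \<and>
     (\<forall>i\<in>{1..k}. \<forall>j\<in>{1..m}. finite (A i j)) \<and>
     disjoint_family_on (\<lambda>(i, j). A i j) ({1..k} \<times> {1..m}) \<and>
     (\<forall>i\<in>{1..k}. \<forall>j\<in>{1..m}. \<forall>a\<in>A i j. V a \<in> carrier_mat (n j) (d i))"

text \<open>The infimum is taken over a nonempty set of nonnegative reals, so the conditionally complete
  \<^const>\<open>Inf\<close> on the reals is the mathematical infimum.\<close>

definition capacity ::
  "nat \<Rightarrow> nat \<Rightarrow> (nat \<Rightarrow> nat) \<Rightarrow> (nat \<Rightarrow> nat) \<Rightarrow> (nat \<Rightarrow> real) \<Rightarrow> (nat \<Rightarrow> nat \<Rightarrow> 'a set) \<Rightarrow>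
     ('a \<Rightarrow> real mat) \<Rightarrow> real" where
  "capacity k m d n p A V =
     (INF Y \<in> {Y :: nat \<Rightarrow> real mat. \<forall>j\<in>{1..m}. Y j \<in> pos_def_mats (n j)}.
        (\<Prod>i\<in>{1..k}. det (finsum_mat (d i) (d i)
           (\<lambda>j. p j \<cdot>\<^sub>m finsum_mat (d i) (d i) (\<lambda>a. transpose_mat (V a) * Y j * V a) (A i j)) {1..m}))
        / (\<Prod>j\<in>{1..m}. det (Y j) powr p j))"

definition feasible ::
  "nat \<Rightarrow> nat \<Rightarrow> (nat \<Rightarrow> nat) \<Rightarrow> (nat \<Rightarrow> nat) \<Rightarrow> (nat \<Rightarrow> real) \<Rightarrow> (nat \<Rightarrow> nat \<Rightarrow> 'a set) \<Rightarrow>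
     ('a \<Rightarrow> real mat) \<Rightarrow> bool" where
  "feasible k m d n p A V \<longleftrightarrow> capacity k m d n p A V > 0"

text \<open>\<open>Mi i\<close> is the inverse of \<open>M i\<close>, and its existence is the invertibility of \<open>M i\<close>.\<close>

definition equivalent_tuples ::
  "nat \<Rightarrow> nat \<Rightarrow> (nat \<Rightarrow> nat) \<Rightarrow> (nat \<Rightarrow> nat) \<Rightarrow> (nat \<Rightarrow> nat \<Rightarrow> 'a set) \<Rightarrow>
     ('a \<Rightarrow> real mat) \<Rightarrow> ('a \<Rightarrow> real mat) \<Rightarrow> bool" where
  "equivalent_tuples k m d n A V V' \<longleftrightarrow>
     (\<exists>M Mi N.
        (\<forall>i\<in>{1..k}. M i \<in> carrier_mat (d i) (d i) \<and> Mi i \<in> carrier_mat (d i) (d i) \<and>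
           inverts_mat (M i) (Mi i) \<and> inverts_mat (Mi i) (M i)) \<and>
        (\<forall>j\<in>{1..m}. N j \<in> carrier_mat (n j) (n j) \<and> invertible_mat (N j)) \<and>
        (\<forall>i\<in>{1..k}. \<forall>j\<in>{1..m}. \<forall>a\<in>A i j. V' a = N j * V a * Mi i))"

end

theory Submission
  imports Defs
begin

text \<open>The scaled tuple comes from a near-minimiser of the capacity, and the estimate on the right
  Gram matrices is a quantitative first-order optimality condition. Write the points of the domain
  of the infimum as \<open>Y\<^sub>j = N\<^sub>j\<^sup>T N\<^sub>j\<close> with \<open>N\<^sub>j\<close> invertible. Choose one whose ratio is within a factor
  \<open>exp \<tau>\<close> of the positive infimum, factor the matrices in the numerator as \<open>M\<^sub>i\<^sup>T M\<^sub>i\<close>, and set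
  \<open>U\<^sub>a = N\<^sub>j V\<^sub>a M\<^sub>i\<^sup>-\<^sup>1\<close>. The first family of equations holds exactly for \<open>U\<close>, and after the change of
  basis the identities are a near-minimiser for \<open>U\<close> (lemma \<open>near_minimiser\<close>).

  Let \<open>W\<^sub>j\<close> be the sum of the matrices \<open>U\<^sub>a U\<^sub>a\<^sup>T\<close> over the arrows into \<open>j\<close>. Move from the identities
  to \<open>E\<^sub>j\<^sup>T E\<^sub>j\<close> in a single block \<open>j\<close>. For positive semidefinite \<open>X\<close> of size \<open>r\<close>,
  \<open>det X \<le> exp (tr X - r)\<close>, so the logarithm of the new numerator is at most the change of the
  total trace of the left sums, and that is \<open>p\<^sub>j\<close> times the change of the trace of \<open>W\<^sub>j\<close>.
  Near-minimality therefore bounds this change below by \<open>p\<^sub>j ln ((det E\<^sub>j)\<^sup>2) - \<tau>\<close>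
  (lemma \<open>trace_block_bound\<close>). Elementary row operations for \<open>E\<^sub>j\<close> now suffice: rescaling one row
  forces the diagonal entries of \<open>W\<^sub>j\<close> towards \<open>1\<close>, and adding a multiple of one row to another,
  which keeps the determinant, forces the others towards \<open>0\<close> (lemma \<open>right_gram_near_one\<close>).
  For small \<open>\<tau>\<close> every entry of \<open>W\<^sub>j\<close> is as close to that of the identity as desired, and so is
  \<open>W\<^sub>j\<close> in every norm.\<close>

section \<open>Cholesky factorisation and a determinant bound\<close>

lemma sum_lessThan_Suc_shift2:
  fixes g :: "nat \<Rightarrow> nat \<Rightarrow> real"
  shows "(\<Sum>i<Suc n. \<Sum>j<Suc n. g i j) =
    g 0 0 + (\<Sum>j<n. g 0 (Suc j)) + (\<Sum>i<n. g (Suc i) 0) + (\<Sum>i<n. \<Sum>j<n. g (Suc i) (Suc j))"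
  by (simp add: sum.lessThan_Suc_shift sum.distrib del: sum.lessThan_Suc)

text \<open>Eliminating the first variable by completing the square leaves a positive semidefinite form in
  the others. A zero pivot does no harm: semidefiniteness then forces the whole first row to
  vanish, and division by zero gives the zero row that is wanted.\<close>

lemma cholesky_fun:
  fixes f :: "nat \<Rightarrow> nat \<Rightarrow> real"
  assumes "\<And>i j. i < n \<Longrightarrow> j < n \<Longrightarrow> f i j = f j i"
    and "\<And>v. 0 \<le> (\<Sum>i<n. \<Sum>j<n. f i j * v i * v j)"
  shows "\<exists>M. (\<forall>l i. i < l \<longrightarrow> M l i = 0) \<and>
    (\<forall>i<n. \<forall>j<n. f i j = (\<Sum>l<n. M l i * M l j))"
  using assms
proof (induction n arbitrary: f)
  case 0
  show ?case by (intro exI[of _ "\<lambda>_ _. 0"]) simp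
next
  case (Suc n)
  have expand: "0 \<le> f 0 0 * t\<^sup>2 + 2 * t * (\<Sum>j<n. f 0 (Suc j) * w j) +
      (\<Sum>i<n. \<Sum>j<n. f (Suc i) (Suc j) * w i * w j)" for t w
  proof -
    have "(\<Sum>i<n. f (Suc i) 0 * w i * t) = (\<Sum>j<n. f 0 (Suc j) * t * w j)"
      by (intro sum.cong) (simp_all add: Suc.prems(1))
    then show ?thesis
      using Suc.prems(2)[of "case_nat t w"]
      by (simp add: sum_lessThan_Suc_shift2 power2_eq_square sum_distrib_left mult_ac del: sum.lessThan_Suc)
  qed
  define r where "r = sqrt (f 0 0)"
  define \<beta> where "\<beta> j = f 0 (Suc j) / r" for j
  have "0 \<le> f 0 0" using expand[of 1 "\<lambda>_. 0"] by simp
  then have r2: "r * r = f 0 0" by (simp add: r_def)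
  have r\<beta>: "r * \<beta> j = f 0 (Suc j)" if j: "j < n" for j
  proof (cases "r = 0")
    case False
    then show ?thesis by (simp add: \<beta>_def)
  next
    case True
    have lin: "0 \<le> 2 * t * f 0 (Suc j) + f (Suc j) (Suc j)" for t
      using expand[of t "\<lambda>i. if i = j then 1 else 0"] j True r2
      by (simp add: if_distrib[of "\<lambda>x. _ * x"] sum.delta cong: if_cong)
    have "f 0 (Suc j) = 0"
    proof (rule ccontr)
      assume "f 0 (Suc j) \<noteq> 0"
      then show False
        using lin[of "- (f (Suc j) (Suc j) + 1) / (2 * f 0 (Suc j))"] by (simp add: field_simps)
    qed
    then show ?thesis using True by simp
  qed
  define f' where "f' i j = f (Suc i) (Suc j) - \<beta> i * \<beta> j" for i j
  have "\<exists>M. (\<forall>l i. i < l \<longrightarrow> M l i = 0) \<and> (\<forall>i<n. \<forall>j<n. f' i j = (\<Sum>l<n. M l i * M l j))"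
  proof (rule Suc.IH)
    show "f' i j = f' j i" if "i < n" "j < n" for i j
      using Suc.prems(1)[of "Suc i" "Suc j"] that by (simp add: f'_def)
    show "0 \<le> (\<Sum>i<n. \<Sum>j<n. f' i j * w i * w j)" for w
    proof -
      define B where "B = (\<Sum>j<n. \<beta> j * w j)"
      have sB: "(\<Sum>j<n. f 0 (Suc j) * w j) = r * B"
        unfolding B_def sum_distrib_left by (intro sum.cong) (simp_all flip: r\<beta>)
      have BB: "(\<Sum>i<n. \<Sum>j<n. \<beta> i * \<beta> j * w i * w j) = B * B"
        unfolding B_def sum_product by (simp add: mult_ac)
      have "B = 0" if "r = 0" using that by (simp add: B_def \<beta>_def)
      \<comment> \<open>\<open>t = - B / r\<close> minimises \<open>r\<^sup>2 t\<^sup>2 + 2 t r B\<close>; for \<open>r = 0\<close> it is \<open>0\<close>, which is right as \<open>B = 0\<close>.\<close>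
      then have "f 0 0 * (- B / r)\<^sup>2 + 2 * (- B / r) * (r * B) = - (B * B)"
        by (cases "r = 0") (simp_all add: power2_eq_square flip: r2)
      then show ?thesis
        using expand[of "- B / r" w] BB unfolding sB
        by (simp add: f'_def left_diff_distrib sum_subtractf)
    qed
  qed
  then obtain M where M: "\<And>l i. i < l \<Longrightarrow> M l i = 0"
    "\<And>i j. i < n \<Longrightarrow> j < n \<Longrightarrow> f' i j = (\<Sum>l<n. M l i * M l j)"
    by (elim exE conjE) (rule that, simp_all)
  let ?M = "\<lambda>l i. case l of 0 \<Rightarrow> (case i of 0 \<Rightarrow> r | Suc j \<Rightarrow> \<beta> j)
                    | Suc l' \<Rightarrow> (case i of 0 \<Rightarrow> 0 | Suc j \<Rightarrow> M l' j)"
  have "?M l i = 0" if "i < l" for l i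
    using that by (auto split: nat.splits intro: M(1))
  moreover have "f i j = (\<Sum>l<Suc n. ?M l i * ?M l j)" if ij: "i < Suc n" "j < Suc n" for i j
  proof (cases i; cases j)
    fix i' j' assume *: "i = Suc i'" "j = Suc j'"
    then have "f i j = \<beta> i' * \<beta> j' + (\<Sum>l<n. M l i' * M l j')"
      using ij M(2)[of i' j'] by (simp add: f'_def)
    then show ?thesis by (simp add: * sum.lessThan_Suc_shift del: sum.lessThan_Suc)
  next
    fix j' assume *: "i = 0" "j = Suc j'"
    then have "f i j = r * \<beta> j'" using ij r\<beta> by simp
    then show ?thesis by (simp add: * sum.lessThan_Suc_shift del: sum.lessThan_Suc)
  next
    fix i' assume *: "i = Suc i'" "j = 0"
    then have "f i j = \<beta> i' * r" using ij r\<beta>[of i'] Suc.prems(1)[of 0 i] by (simp add: mult.commute)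
    then show ?thesis by (simp add: * sum.lessThan_Suc_shift del: sum.lessThan_Suc)
  next
    assume *: "i = 0" "j = 0"
    then have "f i j = r * r" using r2 by simp
    then show ?thesis by (simp add: * sum.lessThan_Suc_shift del: sum.lessThan_Suc)
  qed
  ultimately show ?case by (intro exI[of _ ?M] conjI allI impI)
qed

definition pos_semidef_mat :: "nat \<Rightarrow> real mat \<Rightarrow> bool" where
  "pos_semidef_mat n X \<longleftrightarrow> X \<in> carrier_mat n n \<and> transpose_mat X = X \<and>
     (\<forall>v \<in> carrier_vec n. 0 \<le> v \<bullet> (X *\<^sub>v v))"

lemma index_transpose_mult:
  assumes "P \<in> carrier_mat a b" "Q \<in> carrier_mat a c" "r < b" "s < c"
  shows "(transpose_mat P * Q) $$ (r, s) = (\<Sum>l<a. P $$ (l, r) * Q $$ (l, s))"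
  using assms by (auto simp: scalar_prod_def atLeast0LessThan)

text \<open>The factorisation serves twice. It replaces the symmetric square root in the choice of the
  changes of basis, and its triangular shape reduces the determinant bound below to scalars.\<close>

lemma pos_semidef_mat_cholesky:
  assumes "pos_semidef_mat n X"
  obtains M where "M \<in> carrier_mat n n" "upper_triangular M" "X = transpose_mat M * M"
proof -
  from assms have X: "X \<in> carrier_mat n n" and sym: "transpose_mat X = X"
    and pos: "\<And>v. v \<in> carrier_vec n \<Longrightarrow> 0 \<le> v \<bullet> (X *\<^sub>v v)"
    by (auto simp: pos_semidef_mat_def)
  have "\<exists>M. (\<forall>l i. i < l \<longrightarrow> M l i = 0) \<and>
      (\<forall>i<n. \<forall>j<n. X $$ (i, j) = (\<Sum>l<n. M l i * M l j))"
  proof (rule cholesky_fun)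
    show "X $$ (i, j) = X $$ (j, i)" if "i < n" "j < n" for i j
      using arg_cong[OF sym, of "\<lambda>B. B $$ (j, i)"] that X by simp
    show "0 \<le> (\<Sum>i<n. \<Sum>j<n. X $$ (i, j) * v i * v j)" for v
    proof -
      have "vec n v \<bullet> (X *\<^sub>v vec n v) = (\<Sum>i<n. \<Sum>j<n. X $$ (i, j) * v i * v j)"
        using X by (simp add: scalar_prod_def atLeast0LessThan sum_distrib_left mult_ac)
      then show ?thesis using pos[of "vec n v"] by simp
    qed
  qed
  then obtain M where M: "\<And>l i. i < l \<Longrightarrow> M l i = 0"
    "\<And>i j. i < n \<Longrightarrow> j < n \<Longrightarrow> X $$ (i, j) = (\<Sum>l<n. M l i * M l j)"
    by (elim exE conjE) (rule that, simp_all)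
  let ?M = "mat n n (\<lambda>(l, i). M l i)"
  have "upper_triangular ?M" by (auto intro!: upper_triangularI M(1))
  moreover have "X = transpose_mat ?M * ?M"
    using X by (intro eq_matI) (simp_all add: M(2) scalar_prod_def atLeast0LessThan)
  ultimately show ?thesis by (intro that[of ?M]) auto
qed

lemma det_transpose_mult_self:
  assumes "M \<in> carrier_mat n n"
  shows "det (transpose_mat M * M) = (det (M :: real mat))\<^sup>2"
  using assms by (simp add: det_mult[of _ n] det_transpose power2_eq_square)

lemma pos_semidef_mat_det_nonneg: "pos_semidef_mat n X \<Longrightarrow> 0 \<le> det X"
  by (metis pos_semidef_mat_cholesky det_transpose_mult_self zero_le_power2)

text \<open>With \<open>X = M\<^sup>T M\<close> and \<open>M\<close> triangular, \<open>det X\<close> is the product of the squares of the diagonal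
  of \<open>M\<close>, each at most the corresponding diagonal entry of \<open>X\<close>; then \<open>x \<le> exp (x - 1)\<close> applies
  to each factor. The bound is sharp at the identity matrix, which is why it is good enough to
  detect the distance from the identity.\<close>

lemma pos_semidef_mat_det_le_exp_trace:
  assumes "pos_semidef_mat n X"
  shows "det X \<le> exp ((\<Sum>r<n. X $$ (r, r)) - real n)"
proof -
  obtain M where M: "M \<in> carrier_mat n n" "upper_triangular M" "X = transpose_mat M * M"
    using assms by (rule pos_semidef_mat_cholesky)
  have "det X = (\<Prod>r<n. (M $$ (r, r))\<^sup>2)"
    using M by (simp add: det_transpose_mult_self det_upper_triangular prod_list_diag_prod
        prod_power_distrib atLeast0LessThan)
  also have "\<dots> \<le> (\<Prod>r<n. exp ((M $$ (r, r))\<^sup>2 - 1))"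
    using exp_ge_add_one_self[of "(M $$ (r, r))\<^sup>2 - 1" for r] by (intro prod_mono) simp
  also have "\<dots> = exp ((\<Sum>r<n. (M $$ (r, r))\<^sup>2) - real n)"
    by (simp add: exp_sum[symmetric] sum_subtractf)
  also have "\<dots> \<le> exp ((\<Sum>r<n. X $$ (r, r)) - real n)"
  proof -
    have "(M $$ (r, r))\<^sup>2 \<le> X $$ (r, r)" if "r < n" for r
    proof -
      have "(M $$ (r, r))\<^sup>2 \<le> (\<Sum>l<n. (M $$ (l, r))\<^sup>2)"
        using that by (intro member_le_sum) auto
      then show ?thesis
        using that by (simp add: M(3) index_transpose_mult[OF M(1) M(1)] power2_eq_square
            del: index_mult_mat)
    qed
    then have "(\<Sum>r<n. (M $$ (r, r))\<^sup>2) \<le> (\<Sum>r<n. X $$ (r, r))"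
      by (intro sum_mono) auto
    then show ?thesis by simp
  qed
  finally show ?thesis .
qed

section \<open>Finite sums of matrices\<close>

lemma finsum_mat_carrier:
  assumes "finite S" "\<forall>x\<in>S. f x \<in> carrier_mat nr nc"
  shows "finsum_mat nr nc f S \<in> carrier_mat nr nc"
  using index_finsum_mat[of S f nr nc] assms by blast

lemma finsum_mat_index:
  assumes "finite S" "\<forall>x\<in>S. f x \<in> carrier_mat nr nc" "r < nr" "c < nc"
  shows "finsum_mat nr nc f S $$ (r, c) = (\<Sum>x\<in>S. f x $$ (r, c))"
  using index_finsum_mat[of S f nr nc] assms by blast

lemma finsum_mat_dims:
  assumes "finite S" "\<forall>x\<in>S. f x \<in> carrier_mat nr nc"
  shows "dim_row (finsum_mat nr nc f S) = nr" "dim_col (finsum_mat nr nc f S) = nc"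
  using finsum_mat_carrier[of S f nr nc] assms by auto

lemma finsum_mat_empty: "finsum_mat nr nc f {} = 0\<^sub>m nr nc"
  by (intro eq_matI) (simp_all add: finsum_mat_index finsum_mat_dims)

lemma finsum_mat_insert:
  assumes "finite S" "x \<notin> S" "\<forall>y\<in>insert x S. f y \<in> carrier_mat nr nc"
  shows "finsum_mat nr nc f (insert x S) = f x + finsum_mat nr nc f S"
  by (intro eq_matI) (use assms in \<open>simp_all add: finsum_mat_index finsum_mat_dims\<close>)

lemma finsum_mat_cong:
  assumes "finite S" "\<And>x. x \<in> S \<Longrightarrow> f x = g x" "\<And>x. x \<in> S \<Longrightarrow> g x \<in> carrier_mat nr nc"
  shows "finsum_mat nr nc f S = finsum_mat nr nc g S"
  by (intro eq_matI) (use assms in \<open>simp_all add: finsum_mat_index finsum_mat_dims\<close>)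

lemma congruence_carrier:
  assumes "X \<in> carrier_mat a a" "P \<in> carrier_mat a b"
  shows "transpose_mat P * X * P \<in> carrier_mat b b"
  using assms by (intro mult_carrier_mat[of _ b a] mult_carrier_mat[of "transpose_mat P" b a]) auto

lemma finsum_mat_congruence:
  assumes "finite S" "\<And>x. x \<in> S \<Longrightarrow> f x \<in> carrier_mat a a" "P \<in> carrier_mat a b"
  shows "transpose_mat P * finsum_mat a a f S * P =
    finsum_mat b b (\<lambda>x. transpose_mat P * f x * P) S"
  using assms(1,2)
proof (induction S rule: finite_induct)
  case empty
  show ?case using assms(3) by (simp add: finsum_mat_empty)
next
  case (insert x S)
  have P: "transpose_mat P \<in> carrier_mat b a" "P \<in> carrier_mat a b" using assms(3) by auto
  have fx: "f x \<in> carrier_mat a a" and F: "finsum_mat a a f S \<in> carrier_mat a a"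
    using insert by (auto intro: finsum_mat_carrier)
  have "transpose_mat P * (f x + finsum_mat a a f S) * P =
      transpose_mat P * f x * P + transpose_mat P * finsum_mat a a f S * P"
    using P fx F
    by (simp add: mult_add_distrib_mat[of _ b a _ a] add_mult_distrib_mat[of _ b a _ _ b])
  moreover have "\<forall>y\<in>insert x S. transpose_mat P * f y * P \<in> carrier_mat b b"
    using assms(3) insert.prems by (blast intro: congruence_carrier)
  ultimately show ?case
    using insert by (simp add: finsum_mat_insert)
qed

section \<open>Positive matrices as Gram matrices\<close>

lemma pos_semidef_mat_zero: "pos_semidef_mat n (0\<^sub>m n n)"
  by (auto simp: pos_semidef_mat_def scalar_prod_def)

lemma pos_semidef_mat_add:
  assumes "pos_semidef_mat n X" "pos_semidef_mat n Y"
  shows "pos_semidef_mat n (X + Y)"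
  using assms unfolding pos_semidef_mat_def
  by (auto simp: transpose_add[of _ n n] add_mult_distrib_mat_vec[of _ n n]
      scalar_prod_add_distrib[of _ n] intro!: add_nonneg_nonneg)

lemma pos_semidef_mat_smult:
  assumes "pos_semidef_mat n X" "0 \<le> c"
  shows "pos_semidef_mat n (c \<cdot>\<^sub>m X)"
proof -
  have "v \<bullet> ((c \<cdot>\<^sub>m X) *\<^sub>v v) = c * (v \<bullet> (X *\<^sub>v v))" if "v \<in> carrier_vec n" for v
    using that assms(1)
    by (auto simp: pos_semidef_mat_def scalar_prod_def sum_distrib_left mult_ac)
  moreover have "transpose_mat (c \<cdot>\<^sub>m X) = c \<cdot>\<^sub>m transpose_mat X"
    by (intro eq_matI) auto
  ultimately show ?thesis
    using assms by (auto simp: pos_semidef_mat_def)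
qed

lemma pos_semidef_mat_finsum:
  assumes "finite S" "\<And>x. x \<in> S \<Longrightarrow> pos_semidef_mat n (f x)"
  shows "pos_semidef_mat n (finsum_mat n n f S)"
  using assms
proof (induction S rule: finite_induct)
  case empty
  show ?case by (simp add: finsum_mat_empty pos_semidef_mat_zero)
next
  case (insert x S)
  then have "\<forall>y\<in>insert x S. f y \<in> carrier_mat n n"
    by (auto simp: pos_semidef_mat_def)
  then show ?case using insert by (simp add: finsum_mat_insert pos_semidef_mat_add)
qed

lemma scalar_prod_gram:
  fixes U :: "real mat"
  assumes "U \<in> carrier_mat a b" "v \<in> carrier_vec b"
  shows "v \<bullet> ((transpose_mat U * U) *\<^sub>v v) = (\<Sum>l<a. ((U *\<^sub>v v) $ l)\<^sup>2)"
proof -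
  have "v \<bullet> ((transpose_mat U * U) *\<^sub>v v) = v \<bullet> (transpose_mat U *\<^sub>v (U *\<^sub>v v))"
    using assms by (simp add: assoc_mult_mat_vec[of _ b a])
  also have "\<dots> = (transpose_mat U *\<^sub>v (U *\<^sub>v v)) \<bullet> v"
    using assms by (intro comm_scalar_prod[of _ b]) auto
  also have "\<dots> = (U *\<^sub>v v) \<bullet> (U *\<^sub>v v)"
    using assms by (intro transpose_vec_mult_scalar) auto
  finally show ?thesis
    using assms by (simp add: scalar_prod_def[of "U *\<^sub>v v"] atLeast0LessThan power2_eq_square)
qed

lemma transpose_gram: "U \<in> carrier_mat a b \<Longrightarrow>
    transpose_mat (transpose_mat U * U) = transpose_mat U * (U :: real mat)"
  by (simp add: transpose_mult[of _ b a])

lemma pos_semidef_mat_gram: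
  assumes "U \<in> carrier_mat a b"
  shows "pos_semidef_mat b (transpose_mat U * U)"
  using assms unfolding pos_semidef_mat_def
  by (auto simp: scalar_prod_gram[OF assms] transpose_gram[OF assms] sum_nonneg simp del: assoc_mult_mat_vec)

text \<open>This lets the invertible matrices \<open>N\<close> parametrise the domain of the infimum, so that
  perturbing a point of the domain becomes multiplying \<open>N\<close> by an invertible matrix.\<close>

lemma pos_def_mats_iff_gram:
  "Y \<in> pos_def_mats r \<longleftrightarrow> (\<exists>N \<in> carrier_mat r r. det N \<noteq> 0 \<and> Y = transpose_mat N * N)"
proof
  assume Y: "Y \<in> pos_def_mats r"
  have "0 \<le> v \<bullet> (Y *\<^sub>v v)" if "v \<in> carrier_vec r" for v
    using Y that unfolding pos_def_mats_def
    by (cases "v = 0\<^sub>v r") (auto intro: less_imp_le)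
  then have "pos_semidef_mat r Y"
    using Y by (auto simp: pos_semidef_mat_def pos_def_mats_def)
  then obtain N where N: "N \<in> carrier_mat r r" "Y = transpose_mat N * N"
    by (rule pos_semidef_mat_cholesky)
  have "det N \<noteq> 0"
  proof
    assume "det N = 0"
    then obtain v where v: "v \<in> carrier_vec r" "v \<noteq> 0\<^sub>v r" "N *\<^sub>v v = 0\<^sub>v r"
      using det_0_iff_vec_prod_zero[OF N(1)] by auto
    then have "v \<bullet> (Y *\<^sub>v v) = 0"
      using scalar_prod_gram[OF N(1) v(1)] N(2) by simp
    then show False using Y v by (auto simp: pos_def_mats_def)
  qed
  then show "\<exists>N \<in> carrier_mat r r. det N \<noteq> 0 \<and> Y = transpose_mat N * N" using N by blast
next
  assume "\<exists>N \<in> carrier_mat r r. det N \<noteq> 0 \<and> Y = transpose_mat N * N"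
  then obtain N where N: "N \<in> carrier_mat r r" "det N \<noteq> 0" "Y = transpose_mat N * N" by blast
  have "0 < v \<bullet> (Y *\<^sub>v v)" if v: "v \<in> carrier_vec r" "v \<noteq> 0\<^sub>v r" for v
  proof -
    have "N *\<^sub>v v \<noteq> 0\<^sub>v r" using det_0_iff_vec_prod_zero[OF N(1)] N(2) v by auto
    then obtain l where "l < r" "(N *\<^sub>v v) $ l \<noteq> 0"
      using N(1) by (metis eq_vecI dim_mult_mat_vec carrier_matD(1) index_zero_vec)
    then have "0 < (\<Sum>l<r. ((N *\<^sub>v v) $ l)\<^sup>2)" by (intro sum_pos2[of _ l]) auto
    then show ?thesis using scalar_prod_gram[OF N(1) v(1)] N(3) by simp
  qed
  then show "Y \<in> pos_def_mats r"
    using N(1,3) transpose_gram[OF N(1)] by (auto simp: pos_def_mats_def)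
qed

lemma det_nonzero_inverse:
  assumes "(M :: real mat) \<in> carrier_mat r r" "det M \<noteq> 0"
  obtains M' where "M' \<in> carrier_mat r r" "M * M' = 1\<^sub>m r" "M' * M = 1\<^sub>m r"
  using det_non_zero_imp_unit[OF assms, of undefined]
  by (auto simp: Units_def ring_mat_def)

section \<open>Norms and entries\<close>

text \<open>A form of the equivalence of norms in finite dimension: expand \<open>B\<close> in matrix units and use the
  triangle inequality. It reduces the norm estimate to an estimate of entries.\<close>

lemma matrix_norm_on_entry_bound:
  assumes "matrix_norm_on r nrm"
  shows "\<exists>K\<ge>0. \<forall>B \<in> carrier_mat r r. \<forall>\<eta>. (\<forall>s<r. \<forall>t<r. \<bar>B $$ (s, t)\<bar> \<le> \<eta>) \<longrightarrow> nrm B \<le> K * \<eta>"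
proof -
  define E where "E s t = mat r r (\<lambda>(s', t'). if s' = s \<and> t' = t then 1 else (0::real))" for s t
  let ?I = "{..<r} \<times> {..<r}"
  have E: "E s t \<in> carrier_mat r r" for s t by (simp add: E_def)
  have nonneg: "\<And>B. B \<in> carrier_mat r r \<Longrightarrow> 0 \<le> nrm B"
    and smult: "\<And>c B. B \<in> carrier_mat r r \<Longrightarrow> nrm (c \<cdot>\<^sub>m B) = \<bar>c\<bar> * nrm B"
    and tri: "\<And>B C. B \<in> carrier_mat r r \<Longrightarrow> C \<in> carrier_mat r r \<Longrightarrow> nrm (B + C) \<le> nrm B + nrm C"
    and zero: "nrm (0\<^sub>m r r) = 0"
    using assms by (auto simp: matrix_norm_on_def)
  define K where "K = (\<Sum>(s, t)\<in>?I. nrm (E s t))"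
  have "0 \<le> K" unfolding K_def using nonneg E by (auto intro: sum_nonneg)
  moreover have "nrm B \<le> K * \<eta>"
    if B: "B \<in> carrier_mat r r" and small: "\<forall>s<r. \<forall>t<r. \<bar>B $$ (s, t)\<bar> \<le> \<eta>" for B \<eta>
  proof -
    define f where "f = (\<lambda>x. B $$ x \<cdot>\<^sub>m E (fst x) (snd x))"
    have f: "f x \<in> carrier_mat r r" for x by (simp add: f_def E)
    have sub: "nrm (finsum_mat r r f S) \<le> (\<Sum>x\<in>S. nrm (f x))" if "finite S" for S
      using that
    proof (induction S rule: finite_induct)
      case (insert x S)
      then have "nrm (f x + finsum_mat r r f S) \<le> nrm (f x) + nrm (finsum_mat r r f S)"
        by (intro tri f finsum_mat_carrier) (auto intro: f)
      with insert show ?case using f by (simp add: finsum_mat_insert)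
    qed (simp add: finsum_mat_empty zero)
    have "B = finsum_mat r r f ?I"
    proof (intro eq_matI)
      fix s t assume "s < dim_row (finsum_mat r r f ?I)" "t < dim_col (finsum_mat r r f ?I)"
      then have st: "s < r" "t < r" using f by (simp_all add: finsum_mat_dims)
      have "finsum_mat r r f ?I $$ (s, t) = (\<Sum>x\<in>?I. f x $$ (s, t))"
        using f st by (simp add: finsum_mat_index)
      also have "\<dots> = (\<Sum>x\<in>?I. if x = (s, t) then B $$ (s, t) else 0)"
        using st by (intro sum.cong) (auto simp: f_def E_def)
      finally show "B $$ (s, t) = finsum_mat r r f ?I $$ (s, t)" using st by simp
    qed (use B f in \<open>simp_all add: finsum_mat_dims\<close>)
    then have "nrm B \<le> (\<Sum>x\<in>?I. nrm (f x))" using sub[of ?I] by simp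
    also have "\<dots> \<le> (\<Sum>x\<in>?I. \<eta> * nrm (E (fst x) (snd x)))"
      using small nonneg E by (intro sum_mono) (auto simp: f_def smult intro!: mult_right_mono)
    also have "\<dots> = K * \<eta>" by (simp add: K_def sum_distrib_left case_prod_beta mult.commute)
    finally show ?thesis .
  qed
  ultimately show ?thesis by blast
qed

section \<open>Two elementary inequalities\<close>

text \<open>The function \<open>u \<mapsto> ln u - (u - 1) w\<close> has maximum \<open>0\<close> exactly when \<open>w = 1\<close>. Testing it at
  \<open>u = 1 + h\<close> and \<open>u = 1 - h\<close> gives a lower and an upper bound for \<open>w\<close>.\<close>

lemma near_one_of_log_bound:
  fixes w h :: real
  assumes h: "0 < h" "h \<le> 1 / 3"
    and w: "\<And>u. 0 < u \<Longrightarrow> ln u - h\<^sup>2 \<le> (u - 1) * w"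
  shows "\<bar>w - 1\<bar> \<le> 3 * h"
proof -
  have "h - h\<^sup>2 \<le> ln (1 + h)" "- h - 2 * h\<^sup>2 \<le> ln (1 - h)"
    using h by (auto intro: ln_one_plus_pos_lower_bound ln_one_minus_pos_lower_bound)
  then have "h * (1 - 2 * h) \<le> h * w" "h * w \<le> h * (1 + 3 * h)"
    using w[of "1 + h"] w[of "1 - h"] h by (simp_all add: power2_eq_square algebra_simps)
  then show ?thesis using h by (auto simp: abs_le_iff)
qed

lemma near_zero_of_quadratic_bound:
  fixes x y h :: real
  assumes "0 < h" "y \<le> 2" "\<And>c. - h\<^sup>2 \<le> 2 * c * x + c\<^sup>2 * y"
  shows "\<bar>x\<bar> \<le> 3 * h"
proof -
  have "- h\<^sup>2 \<le> - x\<^sup>2 + x\<^sup>2 / 4 * y"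
    \<comment> \<open>As \<open>y \<le> 2\<close>, this choice of \<open>c\<close> makes the right-hand side at most \<open>- x\<^sup>2 / 2\<close>, whatever the sign of \<open>y\<close>.\<close>
    using assms(3)[of "- x / 2"] by (simp add: power2_eq_square)
  moreover have "x\<^sup>2 / 4 * y \<le> x\<^sup>2 / 4 * 2" using assms(2) by (intro mult_left_mono) auto
  ultimately have "x\<^sup>2 \<le> 9 * h\<^sup>2" using zero_le_power2[of h] by linarith
  then have "x\<^sup>2 \<le> (3 * h)\<^sup>2" by (simp add: power_mult_distrib)
  then show ?thesis using assms(1) abs_le_square_iff[of x "3 * h"] by simp
qed

section \<open>The two Gram matrices of a tuple of matrices on the arrows\<close>

text \<open>Positive weights and finite arrow sets are part of the predicate, so that this one hypothesis
  carries the whole setting through the lemmas. A tuple takes the vertices \<open>i\<close> and \<open>j\<close> as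
  arguments besides the arrow \<open>a\<close>: the matrices \<open>N\<^sub>j V\<^sub>a P\<^sub>i\<close> can then be written down without
  recovering \<open>i\<close> and \<open>j\<close> from \<open>a\<close>.\<close>

definition arrows_fit ::
  "nat \<Rightarrow> nat \<Rightarrow> (nat \<Rightarrow> nat) \<Rightarrow> (nat \<Rightarrow> nat) \<Rightarrow> (nat \<Rightarrow> real) \<Rightarrow> (nat \<Rightarrow> nat \<Rightarrow> 'a set) \<Rightarrow>
     (nat \<Rightarrow> nat \<Rightarrow> 'a \<Rightarrow> real mat) \<Rightarrow> bool" where
  "arrows_fit k m d n p A U \<longleftrightarrow>
     (\<forall>j\<in>{1..m}. 0 < p j) \<and>
     (\<forall>i\<in>{1..k}. \<forall>j\<in>{1..m}. finite (A i j)) \<and>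
     (\<forall>i\<in>{1..k}. \<forall>j\<in>{1..m}. \<forall>a\<in>A i j. U i j a \<in> carrier_mat (n j) (d i))"

definition left_gram ::
  "nat \<Rightarrow> (nat \<Rightarrow> nat) \<Rightarrow> (nat \<Rightarrow> real) \<Rightarrow> (nat \<Rightarrow> nat \<Rightarrow> 'a set) \<Rightarrow>
     (nat \<Rightarrow> nat \<Rightarrow> 'a \<Rightarrow> real mat) \<Rightarrow> nat \<Rightarrow> real mat" where
  "left_gram m d p A U i = finsum_mat (d i) (d i)
     (\<lambda>j. p j \<cdot>\<^sub>m finsum_mat (d i) (d i) (\<lambda>a. transpose_mat (U i j a) * U i j a) (A i j)) {1..m}"

definition right_gram ::
  "nat \<Rightarrow> (nat \<Rightarrow> nat) \<Rightarrow> (nat \<Rightarrow> nat \<Rightarrow> 'a set) \<Rightarrow>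
     (nat \<Rightarrow> nat \<Rightarrow> 'a \<Rightarrow> real mat) \<Rightarrow> nat \<Rightarrow> real mat" where
  "right_gram k n A U j = finsum_mat (n j) (n j)
     (\<lambda>i. finsum_mat (n j) (n j) (\<lambda>a. U i j a * transpose_mat (U i j a)) (A i j)) {1..k}"

definition capacity_ratio ::
  "nat \<Rightarrow> nat \<Rightarrow> (nat \<Rightarrow> nat) \<Rightarrow> (nat \<Rightarrow> real) \<Rightarrow> (nat \<Rightarrow> nat \<Rightarrow> 'a set) \<Rightarrow>
     ('a \<Rightarrow> real mat) \<Rightarrow> (nat \<Rightarrow> real mat) \<Rightarrow> real" where
  "capacity_ratio k m d p A V Y =
     (\<Prod>i\<in>{1..k}. det (finsum_mat (d i) (d i)
        (\<lambda>j. p j \<cdot>\<^sub>m finsum_mat (d i) (d i) (\<lambda>a. transpose_mat (V a) * Y j * V a) (A i j)) {1..m}))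
     / (\<Prod>j\<in>{1..m}. det (Y j) powr p j)"

text \<open>If the left Gram matrices of \<open>U\<close> are identities, the capacity ratio of \<open>U\<close> at the identities is
  \<open>1\<close>, and this says that no point \<open>E\<^sub>j\<^sup>T E\<^sub>j\<close> pushes it below \<open>exp (- \<tau>)\<close>. The denominator is
  multiplied out so that products of determinants can be compared directly.\<close>

definition almost_minimal ::
  "nat \<Rightarrow> nat \<Rightarrow> (nat \<Rightarrow> nat) \<Rightarrow> (nat \<Rightarrow> nat) \<Rightarrow> (nat \<Rightarrow> real) \<Rightarrow> (nat \<Rightarrow> nat \<Rightarrow> 'a set) \<Rightarrow>
     real \<Rightarrow> (nat \<Rightarrow> nat \<Rightarrow> 'a \<Rightarrow> real mat) \<Rightarrow> bool" where
  "almost_minimal k m d n p A \<tau> U \<longleftrightarrow>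
     (\<forall>E. (\<forall>j\<in>{1..m}. E j \<in> carrier_mat (n j) (n j) \<and> det (E j) \<noteq> 0) \<longrightarrow>
       exp (- \<tau>) * (\<Prod>j\<in>{1..m}. (det (E j))\<^sup>2 powr p j) \<le>
       (\<Prod>i\<in>{1..k}. det (left_gram m d p A (\<lambda>i j a. E j * U i j a) i)))"

lemma arrows_fit_weight_pos: "arrows_fit k m d n p A U \<Longrightarrow> j \<in> {1..m} \<Longrightarrow> 0 < p j"
  by (simp add: arrows_fit_def)

lemma arrows_fit_finite:
  "arrows_fit k m d n p A U \<Longrightarrow> i \<in> {1..k} \<Longrightarrow> j \<in> {1..m} \<Longrightarrow> finite (A i j)"
  by (simp add: arrows_fit_def)

lemma arrows_fitD:
  "arrows_fit k m d n p A U \<Longrightarrow> i \<in> {1..k} \<Longrightarrow> j \<in> {1..m} \<Longrightarrow> a \<in> A i j \<Longrightarrow> U i j a \<in> carrier_mat (n j) (d i)"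
  by (simp add: arrows_fit_def)

lemma left_gram_psd:
  assumes "arrows_fit k m d n p A U" "i \<in> {1..k}"
  shows "pos_semidef_mat (d i) (left_gram m d p A U i)"
  unfolding left_gram_def
  using assms arrows_fit_weight_pos[OF assms(1)] arrows_fit_finite[OF assms(1)]
  by (intro pos_semidef_mat_finsum pos_semidef_mat_smult)
    (auto intro!: pos_semidef_mat_gram arrows_fitD less_imp_le)

lemma left_gram_carrier:
  assumes "arrows_fit k m d n p A U" "i \<in> {1..k}"
  shows "left_gram m d p A U i \<in> carrier_mat (d i) (d i)"
  using left_gram_psd[OF assms] by (simp add: pos_semidef_mat_def)

lemma left_gram_cong:
  assumes "\<And>j a. j \<in> {1..m} \<Longrightarrow> a \<in> A i j \<Longrightarrow> U i j a = U' i j a"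
    and "arrows_fit k m d n p A U'" "i \<in> {1..k}"
  shows "left_gram m d p A U i = left_gram m d p A U' i"
proof -
  have *: "finsum_mat (d i) (d i) (\<lambda>a. transpose_mat (U i j a) * U i j a) (A i j) =
      finsum_mat (d i) (d i) (\<lambda>a. transpose_mat (U' i j a) * U' i j a) (A i j)" if "j \<in> {1..m}" for j
    using assms that arrows_fitD[OF assms(2,3) that] arrows_fit_finite[OF assms(2)]
    by (intro finsum_mat_cong) (auto intro!: mult_carrier_mat[of _ _ "n j"])
  show ?thesis unfolding left_gram_def
    using * arrows_fitD[OF assms(2,3)] arrows_fit_finite[OF assms(2)] assms(3)
    by (intro finsum_mat_cong)
      (auto intro!: smult_carrier_mat finsum_mat_carrier mult_carrier_mat[of _ _ "n _"])
qed

lemma left_gram_entry: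
  assumes "arrows_fit k m d n p A U" "i \<in> {1..k}" "r < d i" "c < d i"
  shows "left_gram m d p A U i $$ (r, c) =
    (\<Sum>j\<in>{1..m}. p j * (\<Sum>a\<in>A i j. \<Sum>l<n j. U i j a $$ (l, r) * U i j a $$ (l, c)))"
proof -
  let ?g = "\<lambda>j. finsum_mat (d i) (d i) (\<lambda>a. transpose_mat (U i j a) * U i j a) (A i j)"
  have U: "U i j a \<in> carrier_mat (n j) (d i)" if "j \<in> {1..m}" "a \<in> A i j" for j a
    using assms that by (intro arrows_fitD)
  have fin: "finite (A i j)" if "j \<in> {1..m}" for j using arrows_fit_finite[OF assms(1)] assms(2) that by simp
  have UU: "\<forall>a\<in>A i j. transpose_mat (U i j a) * U i j a \<in> carrier_mat (d i) (d i)" if "j \<in> {1..m}" for j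
    using U that by (auto intro!: mult_carrier_mat[of _ _ "n j"])
  have g: "?g j \<in> carrier_mat (d i) (d i)" if "j \<in> {1..m}" for j
    using that fin UU by (intro finsum_mat_carrier) auto
  have gi: "?g j $$ (r, c) = (\<Sum>a\<in>A i j. \<Sum>l<n j. U i j a $$ (l, r) * U i j a $$ (l, c))"
    if "j \<in> {1..m}" for j
    using that assms UU[OF that] fin
    by (subst finsum_mat_index) (auto intro!: sum.cong index_transpose_mult[OF U U])
  have "left_gram m d p A U i $$ (r, c) = (\<Sum>j\<in>{1..m}. (p j \<cdot>\<^sub>m ?g j) $$ (r, c))"
    unfolding left_gram_def using assms g by (intro finsum_mat_index) auto
  also have "\<dots> = (\<Sum>j\<in>{1..m}. p j * ?g j $$ (r, c))"
    using assms by (intro sum.cong refl index_smult_mat(1)) (simp_all only: carrier_matD[OF g])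
  finally show ?thesis using gi by simp
qed

lemma right_gram_carrier_entry:
  assumes "arrows_fit k m d n p A U" "j \<in> {1..m}"
  shows "right_gram k n A U j \<in> carrier_mat (n j) (n j)"
    and "r < n j \<Longrightarrow> s < n j \<Longrightarrow> right_gram k n A U j $$ (r, s) =
      (\<Sum>i\<in>{1..k}. \<Sum>a\<in>A i j. \<Sum>c<d i. U i j a $$ (r, c) * U i j a $$ (s, c))"
proof -
  let ?g = "\<lambda>i. finsum_mat (n j) (n j) (\<lambda>a. U i j a * transpose_mat (U i j a)) (A i j)"
  have U: "U i j a \<in> carrier_mat (n j) (d i)" if "i \<in> {1..k}" "a \<in> A i j" for i a
    using assms that by (intro arrows_fitD)
  have fin: "finite (A i j)" if "i \<in> {1..k}" for i using arrows_fit_finite[OF assms(1)] assms(2) that by simp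
  have UU: "\<forall>a\<in>A i j. U i j a * transpose_mat (U i j a) \<in> carrier_mat (n j) (n j)" if "i \<in> {1..k}" for i
    using U that by (auto intro!: mult_carrier_mat[of _ _ "d i"])
  have g: "?g i \<in> carrier_mat (n j) (n j)" if "i \<in> {1..k}" for i
    using that fin UU by (intro finsum_mat_carrier) auto
  show "right_gram k n A U j \<in> carrier_mat (n j) (n j)"
    unfolding right_gram_def using g by (intro finsum_mat_carrier) auto
  assume rs: "r < n j" "s < n j"
  have gi: "?g i $$ (r, s) = (\<Sum>a\<in>A i j. \<Sum>c<d i. U i j a $$ (r, c) * U i j a $$ (s, c))"
    if i: "i \<in> {1..k}" for i
  proof -
    have "(U i j a * transpose_mat (U i j a)) $$ (r, s) =
        (\<Sum>c<d i. U i j a $$ (r, c) * U i j a $$ (s, c))" if "a \<in> A i j" for a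
      using U[OF i that] rs by (auto simp: scalar_prod_def atLeast0LessThan)
    then show ?thesis
      using i rs UU[OF i] fin by (subst finsum_mat_index) (auto intro!: sum.cong)
  qed
  have "right_gram k n A U j $$ (r, s) = (\<Sum>i\<in>{1..k}. ?g i $$ (r, s))"
    unfolding right_gram_def using rs g by (intro finsum_mat_index) auto
  then show "right_gram k n A U j $$ (r, s) =
      (\<Sum>i\<in>{1..k}. \<Sum>a\<in>A i j. \<Sum>c<d i. U i j a $$ (r, c) * U i j a $$ (s, c))"
    using gi by simp
qed

lemma right_gram_cong:
  assumes "\<And>i a. i \<in> {1..k} \<Longrightarrow> a \<in> A i j \<Longrightarrow> U i j a = U' i j a"
    and "arrows_fit k m d n p A U'" "j \<in> {1..m}"
  shows "right_gram k n A U j = right_gram k n A U' j"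
proof -
  have *: "finsum_mat (n j) (n j) (\<lambda>a. U i j a * transpose_mat (U i j a)) (A i j) =
      finsum_mat (n j) (n j) (\<lambda>a. U' i j a * transpose_mat (U' i j a)) (A i j)" if "i \<in> {1..k}" for i
    using assms that arrows_fitD[OF assms(2) that assms(3)] arrows_fit_finite[OF assms(2)]
    by (intro finsum_mat_cong) (auto intro!: mult_carrier_mat[of _ _ "d i"])
  show ?thesis unfolding right_gram_def
    using * arrows_fitD[OF assms(2) _ assms(3)] arrows_fit_finite[OF assms(2)] assms(3)
    by - (rule finsum_mat_cong, auto intro!: finsum_mat_carrier mult_carrier_mat[of _ _ "d _"])
qed

text \<open>Both sides are the weighted sum of the squares of all entries of all the matrices.\<close>

lemma trace_left_gram_eq_trace_right_gram:
  assumes "arrows_fit k m d n p A U"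
  shows "(\<Sum>i\<in>{1..k}. \<Sum>r<d i. left_gram m d p A U i $$ (r, r)) =
    (\<Sum>j\<in>{1..m}. p j * (\<Sum>r<n j. right_gram k n A U j $$ (r, r)))"
proof -
  define u where "u i j a r c = (U i j a $$ (r, c))\<^sup>2" for i j a r c
  have swap: "(\<Sum>c<d i. \<Sum>a\<in>A i j. \<Sum>l<n j. u i j a l c) = (\<Sum>l<n j. \<Sum>a\<in>A i j. \<Sum>c<d i. u i j a l c)"
    for i j
  proof -
    have "(\<Sum>c<d i. \<Sum>a\<in>A i j. \<Sum>l<n j. u i j a l c) = (\<Sum>a\<in>A i j. \<Sum>c<d i. \<Sum>l<n j. u i j a l c)"
      by (rule sum.swap)
    also have "\<dots> = (\<Sum>a\<in>A i j. \<Sum>l<n j. \<Sum>c<d i. u i j a l c)"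
      by (intro sum.cong refl sum.swap)
    also have "\<dots> = (\<Sum>l<n j. \<Sum>a\<in>A i j. \<Sum>c<d i. u i j a l c)"
      by (rule sum.swap)
    finally show ?thesis .
  qed
  have "(\<Sum>i\<in>{1..k}. \<Sum>r<d i. left_gram m d p A U i $$ (r, r)) =
      (\<Sum>i\<in>{1..k}. \<Sum>r<d i. \<Sum>j\<in>{1..m}. p j * (\<Sum>a\<in>A i j. \<Sum>l<n j. u i j a l r))"
    using assms by (simp add: left_gram_entry u_def power2_eq_square)
  also have "\<dots> = (\<Sum>i\<in>{1..k}. \<Sum>j\<in>{1..m}. p j * (\<Sum>c<d i. \<Sum>a\<in>A i j. \<Sum>l<n j. u i j a l c))"
    by (simp only: sum_distrib_left sum.swap[of _ "{1..m}" "{..<d _}"])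
  also have "\<dots> = (\<Sum>j\<in>{1..m}. \<Sum>i\<in>{1..k}. p j * (\<Sum>c<d i. \<Sum>a\<in>A i j. \<Sum>l<n j. u i j a l c))"
    by (rule sum.swap)
  also have "\<dots> = (\<Sum>j\<in>{1..m}. p j * (\<Sum>i\<in>{1..k}. \<Sum>l<n j. \<Sum>a\<in>A i j. \<Sum>c<d i. u i j a l c))"
    by (simp only: sum_distrib_left[symmetric] swap)
  also have "\<dots> = (\<Sum>j\<in>{1..m}. p j * (\<Sum>l<n j. \<Sum>i\<in>{1..k}. \<Sum>a\<in>A i j. \<Sum>c<d i. u i j a l c))"
    by (intro sum.cong refl arg_cong[of _ _ "(*) (p _)"] sum.swap)
  also have "\<dots> = (\<Sum>j\<in>{1..m}. p j * (\<Sum>r<n j. right_gram k n A U j $$ (r, r)))"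
    using assms by (simp add: right_gram_carrier_entry(2) u_def power2_eq_square)
  finally show ?thesis .
qed

lemma left_gram_mult_right:
  assumes U: "arrows_fit k m d n p A U" and i: "i \<in> {1..k}" and P: "P i \<in> carrier_mat (d i) (d i)"
  shows "left_gram m d p A (\<lambda>i j a. U i j a * P i) i = transpose_mat (P i) * left_gram m d p A U i * P i"
proof -
  have fit: "U i j a \<in> carrier_mat (n j) (d i)" if "j \<in> {1..m}" "a \<in> A i j" for j a
    using U i that by (intro arrows_fitD)
  have fin: "finite (A i j)" if "j \<in> {1..m}" for j using arrows_fit_finite[OF U] i that by simp
  let ?G = "\<lambda>j. finsum_mat (d i) (d i) (\<lambda>a. transpose_mat (U i j a) * U i j a) (A i j)"
  let ?G' = "\<lambda>j. finsum_mat (d i) (d i)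
    (\<lambda>a. transpose_mat (U i j a * P i) * (U i j a * P i)) (A i j)"
  have UU: "transpose_mat (U i j a) * U i j a \<in> carrier_mat (d i) (d i)"
    if "j \<in> {1..m}" "a \<in> A i j" for j a
    using fit[OF that] by (auto intro!: mult_carrier_mat[of _ _ "n j"])
  have G: "?G j \<in> carrier_mat (d i) (d i)" if "j \<in> {1..m}" for j
    using that fin UU by (intro finsum_mat_carrier) auto
  have G': "p j \<cdot>\<^sub>m ?G' j = transpose_mat (P i) * (p j \<cdot>\<^sub>m ?G j) * P i" if j: "j \<in> {1..m}" for j
  proof -
    have "transpose_mat (U i j a * P i) * (U i j a * P i) =
        transpose_mat (P i) * (transpose_mat (U i j a) * U i j a) * P i" if "a \<in> A i j" for a
    proof -
      note Ua = fit[OF j that]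
      have T: "transpose_mat (U i j a) \<in> carrier_mat (d i) (n j)"
        "transpose_mat (P i) \<in> carrier_mat (d i) (d i)" using Ua P by auto
      have "transpose_mat (U i j a * P i) * (U i j a * P i) =
          transpose_mat (P i) * transpose_mat (U i j a) * (U i j a * P i)"
        using transpose_mult[OF Ua P] by simp
      also have "\<dots> = transpose_mat (P i) * (transpose_mat (U i j a) * (U i j a * P i))"
        using Ua P T by (intro assoc_mult_mat) auto
      also have "transpose_mat (U i j a) * (U i j a * P i) = transpose_mat (U i j a) * U i j a * P i"
        using Ua P T by (intro assoc_mult_mat[symmetric]) auto
      also have "transpose_mat (P i) * (transpose_mat (U i j a) * U i j a * P i) =
          transpose_mat (P i) * (transpose_mat (U i j a) * U i j a) * P i"
        using UU[OF j that] P T by (intro assoc_mult_mat[symmetric]) auto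
      finally show ?thesis .
    qed
    moreover have "\<forall>a\<in>A i j. transpose_mat (P i) * (transpose_mat (U i j a) * U i j a) * P i
        \<in> carrier_mat (d i) (d i)"
      using UU j P by (intro ballI congruence_carrier) auto
    ultimately have "?G' j = finsum_mat (d i) (d i)
        (\<lambda>a. transpose_mat (P i) * (transpose_mat (U i j a) * U i j a) * P i) (A i j)"
      using fin[OF j] by (intro finsum_mat_cong) auto
    also have "\<dots> = transpose_mat (P i) * ?G j * P i"
      using fin[OF j] UU[OF j] P by (intro finsum_mat_congruence[symmetric]) auto
    finally have "?G' j = transpose_mat (P i) * ?G j * P i" .
    moreover have "transpose_mat (P i) * (p j \<cdot>\<^sub>m ?G j) * P i = p j \<cdot>\<^sub>m (transpose_mat (P i) * ?G j * P i)"
      using G[OF j] P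
      by (simp add: mult_smult_distrib[of _ "d i" "d i"] mult_smult_assoc_mat[of _ "d i" "d i"])
    ultimately show ?thesis by simp
  qed
  have "left_gram m d p A (\<lambda>i j a. U i j a * P i) i = finsum_mat (d i) (d i) (\<lambda>j. p j \<cdot>\<^sub>m ?G' j) {1..m}"
    by (simp add: left_gram_def)
  also have "\<dots> = finsum_mat (d i) (d i) (\<lambda>j. transpose_mat (P i) * (p j \<cdot>\<^sub>m ?G j) * P i) {1..m}"
    using G' G P by (intro finsum_mat_cong ballI congruence_carrier smult_carrier_mat) auto
  also have "\<dots> = transpose_mat (P i) * left_gram m d p A U i * P i"
    unfolding left_gram_def using G P by (intro finsum_mat_congruence[symmetric]) auto
  finally show ?thesis .
qed

section \<open>Near-minimisers of the capacity\<close>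

lemma arrows_fit_mult_left:
  assumes "arrows_fit k m d n p A U" "\<And>j. j \<in> {1..m} \<Longrightarrow> E j \<in> carrier_mat (n j) (n j)"
  shows "arrows_fit k m d n p A (\<lambda>i j a. E j * U i j a)"
  unfolding arrows_fit_def
  using assms by (intro conjI ballI mult_carrier_mat[of _ "n _" "n _"]) (auto simp: arrows_fit_def)

lemma arrows_fit_mult_right:
  assumes "arrows_fit k m d n p A U" "\<And>i. i \<in> {1..k} \<Longrightarrow> P i \<in> carrier_mat (d i) (d i)"
  shows "arrows_fit k m d n p A (\<lambda>i j a. U i j a * P i)"
  unfolding arrows_fit_def
  using assms by (intro conjI ballI mult_carrier_mat[of _ "n _" "d _"]) (auto simp: arrows_fit_def)

lemma capacity_ratio_gram:
  assumes V: "arrows_fit k m d n p A (\<lambda>i j a. V a)"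
    and N: "\<And>j. j \<in> {1..m} \<Longrightarrow> N j \<in> carrier_mat (n j) (n j)"
    and Y: "\<And>j. j \<in> {1..m} \<Longrightarrow> Y j = transpose_mat (N j) * N j"
  shows "capacity_ratio k m d p A V Y =
    (\<Prod>i\<in>{1..k}. det (left_gram m d p A (\<lambda>i j a. N j * V a) i)) / (\<Prod>j\<in>{1..m}. (det (N j))\<^sup>2 powr p j)"
proof -
  have "finsum_mat (d i) (d i)
        (\<lambda>j. p j \<cdot>\<^sub>m finsum_mat (d i) (d i) (\<lambda>a. transpose_mat (V a) * Y j * V a) (A i j)) {1..m}
      = left_gram m d p A (\<lambda>i j a. N j * V a) i" if i: "i \<in> {1..k}" for i
  proof -
    have eq: "transpose_mat (V a) * Y j * V a = transpose_mat (N j * V a) * (N j * V a)"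
      and car: "transpose_mat (N j * V a) * (N j * V a) \<in> carrier_mat (d i) (d i)"
      if j: "j \<in> {1..m}" and a: "a \<in> A i j" for j a
    proof -
      have Va: "V a \<in> carrier_mat (n j) (d i)" using V i j a by (rule arrows_fitD)
      note Nj = N[OF j]
      have T: "transpose_mat (V a) \<in> carrier_mat (d i) (n j)"
        "transpose_mat (N j) \<in> carrier_mat (n j) (n j)" using Va Nj by auto
      have NV: "N j * V a \<in> carrier_mat (n j) (d i)" using Nj Va by (rule mult_carrier_mat)
      show "transpose_mat (N j * V a) * (N j * V a) \<in> carrier_mat (d i) (d i)"
        using pos_semidef_mat_gram[OF NV] unfolding pos_semidef_mat_def by blast
      have "transpose_mat (N j * V a) * (N j * V a) = transpose_mat (V a) * transpose_mat (N j) * (N j * V a)"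
        using transpose_mult[OF Nj Va] by simp
      also have "\<dots> = transpose_mat (V a) * (transpose_mat (N j) * (N j * V a))"
        using T NV by (rule assoc_mult_mat)
      also have "transpose_mat (N j) * (N j * V a) = Y j * V a"
        using assoc_mult_mat[OF T(2) Nj Va] Y[OF j] by simp
      also have "transpose_mat (V a) * (Y j * V a) = transpose_mat (V a) * Y j * V a"
        using Y[OF j] T Nj Va by (intro assoc_mult_mat[symmetric]) auto
      finally show "transpose_mat (V a) * Y j * V a = transpose_mat (N j * V a) * (N j * V a)" by simp
    qed
    have "finsum_mat (d i) (d i) (\<lambda>a. transpose_mat (V a) * Y j * V a) (A i j) =
        finsum_mat (d i) (d i) (\<lambda>a. transpose_mat (N j * V a) * (N j * V a)) (A i j)"
      if "j \<in> {1..m}" for j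
      using that arrows_fit_finite[OF V] i eq car by (intro finsum_mat_cong) auto
    then show ?thesis
      unfolding left_gram_def using arrows_fit_finite[OF V] i car
      by (intro finsum_mat_cong) (auto intro!: smult_carrier_mat finsum_mat_carrier)
  qed
  moreover have "det (Y j) = (det (N j))\<^sup>2" if "j \<in> {1..m}" for j
    using Y[OF that] det_transpose_mult_self[OF N[OF that]] by simp
  ultimately show ?thesis by (simp add: capacity_ratio_def)
qed

text \<open>An infimum of reals is a lower bound only of a set that is bounded below; here \<open>0\<close> is a bound,
  as determinants of positive semidefinite matrices are nonnegative.\<close>

lemma capacity_le_ratio:
  assumes V: "arrows_fit k m d n p A (\<lambda>i j a. V a)" and Y: "\<And>j. j \<in> {1..m} \<Longrightarrow> Y j \<in> pos_def_mats (n j)"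
  shows "capacity k m d n p A V \<le> capacity_ratio k m d p A V Y"
  unfolding capacity_def capacity_ratio_def[symmetric]
proof (rule cINF_lower)
  show "bdd_below (capacity_ratio k m d p A V ` {Y. \<forall>j\<in>{1..m}. Y j \<in> pos_def_mats (n j)})"
  proof (rule bdd_belowI2[of _ 0])
    fix Z :: "nat \<Rightarrow> real mat"
    assume "Z \<in> {Y. \<forall>j\<in>{1..m}. Y j \<in> pos_def_mats (n j)}"
    then have "\<forall>j\<in>{1..m}. \<exists>N. N \<in> carrier_mat (n j) (n j) \<and> Z j = transpose_mat N * N"
      by (auto simp: pos_def_mats_iff_gram)
    then obtain N where N: "\<And>j. j \<in> {1..m} \<Longrightarrow> N j \<in> carrier_mat (n j) (n j)"
      "\<And>j. j \<in> {1..m} \<Longrightarrow> Z j = transpose_mat (N j) * N j" by metis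
    have "capacity_ratio k m d p A V Z = (\<Prod>i\<in>{1..k}. det (left_gram m d p A (\<lambda>i j a. N j * V a) i)) /
        (\<Prod>j\<in>{1..m}. (det (N j))\<^sup>2 powr p j)"
      using V N by (rule capacity_ratio_gram)
    moreover have "arrows_fit k m d n p A (\<lambda>i j a. N j * V a)" using V N(1) by (rule arrows_fit_mult_left)
    ultimately show "0 \<le> capacity_ratio k m d p A V Z"
      by (auto intro!: divide_nonneg_nonneg prod_nonneg pos_semidef_mat_det_nonneg left_gram_psd)
  qed
qed (use Y in auto)

text \<open>Take \<open>Y\<^sub>j = N\<^sub>j\<^sup>T N\<^sub>j\<close> whose ratio is within a factor \<open>exp \<tau>\<close> of the infimum, and let \<open>P\<^sub>i\<close> be the
  inverse of a factor \<open>M\<^sub>i\<close> of the left Gram matrix \<open>M\<^sub>i\<^sup>T M\<^sub>i\<close>. That matrix is invertible because the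
  ratio is positive, which is where feasibility enters. The change of basis makes the left Gram
  matrices identities, and it multiplies all ratios by one common constant, so near-minimality
  at \<open>Y\<close> turns into near-minimality at the identities.\<close>

lemma near_minimiser:
  assumes V: "arrows_fit k m d n p A (\<lambda>i j a. V a)" and feas: "feasible k m d n p A V" and \<tau>: "0 < \<tau>"
  obtains N P P' where
    "\<And>j. j \<in> {1..m} \<Longrightarrow> N j \<in> carrier_mat (n j) (n j)"
    "\<And>j. j \<in> {1..m} \<Longrightarrow> det (N j) \<noteq> 0"
    "\<And>i. i \<in> {1..k} \<Longrightarrow> P i \<in> carrier_mat (d i) (d i)"
    "\<And>i. i \<in> {1..k} \<Longrightarrow> P' i \<in> carrier_mat (d i) (d i)"
    "\<And>i. i \<in> {1..k} \<Longrightarrow> P i * P' i = 1\<^sub>m (d i)"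
    "\<And>i. i \<in> {1..k} \<Longrightarrow> P' i * P i = 1\<^sub>m (d i)"
    "\<And>i. i \<in> {1..k} \<Longrightarrow> left_gram m d p A (\<lambda>i j a. N j * V a * P i) i = 1\<^sub>m (d i)"
    "almost_minimal k m d n p A \<tau> (\<lambda>i j a. N j * V a * P i)"
proof -
  define C where "C = capacity k m d n p A V"
  have C: "0 < C" using feas by (simp add: feasible_def C_def)
  let ?pd = "{Y. \<forall>j\<in>{1..m}. Y j \<in> pos_def_mats (n j)}"
  have "(\<lambda>j. 1\<^sub>m (n j)) \<in> ?pd"
    by (auto simp: pos_def_mats_iff_gram intro!: bexI[of _ "1\<^sub>m _"])
  then have "?pd \<noteq> {}" by (metis (no_types, lifting) empty_iff)
  moreover have "(INF Y\<in>?pd. capacity_ratio k m d p A V Y) = C"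
    by (simp add: C_def capacity_def capacity_ratio_def)
  moreover have "C < C * exp \<tau>" using C \<tau> by simp
  ultimately obtain Y where Y: "Y \<in> ?pd" "capacity_ratio k m d p A V Y < C * exp \<tau>"
    using cInf_lessD[of "capacity_ratio k m d p A V ` ?pd" "C * exp \<tau>"] by auto
  from Y(1) have "\<forall>j\<in>{1..m}. \<exists>N. N \<in> carrier_mat (n j) (n j) \<and> det N \<noteq> 0 \<and> Y j = transpose_mat N * N"
    by (auto simp: pos_def_mats_iff_gram)
  then obtain N where N: "\<And>j. j \<in> {1..m} \<Longrightarrow> N j \<in> carrier_mat (n j) (n j)"
    "\<And>j. j \<in> {1..m} \<Longrightarrow> Y j = transpose_mat (N j) * N j"
    "\<And>j. j \<in> {1..m} \<Longrightarrow> det (N j) \<noteq> 0" by metis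
  define X where "X = left_gram m d p A (\<lambda>i j a. N j * V a)"
  have NV: "arrows_fit k m d n p A (\<lambda>i j a. N j * V a)" using V N(1) by (rule arrows_fit_mult_left)
  have ratio: "capacity_ratio k m d p A V Y = (\<Prod>i\<in>{1..k}. det (X i)) / (\<Prod>j\<in>{1..m}. (det (N j))\<^sup>2 powr p j)"
    using capacity_ratio_gram[OF V N(1,2)] by (simp add: X_def)
  have pos: "0 < capacity_ratio k m d p A V Y" using capacity_le_ratio[OF V, of Y] Y(1) C by (simp add: C_def)
  have detX: "det (X i) \<noteq> 0" if "i \<in> {1..k}" for i
  proof
    assume "det (X i) = 0"
    then have "(\<Prod>i\<in>{1..k}. det (X i)) = 0" using that by (intro prod_zero) auto
    then have "capacity_ratio k m d p A V Y = 0" unfolding ratio by (simp only: div_0)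
    then show False using pos by simp
  qed
  have "\<exists>P P'. P \<in> carrier_mat (d i) (d i) \<and> P' \<in> carrier_mat (d i) (d i) \<and> P * P' = 1\<^sub>m (d i) \<and>
      P' * P = 1\<^sub>m (d i) \<and> transpose_mat P * X i * P = 1\<^sub>m (d i)" if i: "i \<in> {1..k}" for i
  proof -
    have "pos_semidef_mat (d i) (X i)" unfolding X_def using NV i by (rule left_gram_psd)
    then obtain M where M: "M \<in> carrier_mat (d i) (d i)" "X i = transpose_mat M * M"
      by (rule pos_semidef_mat_cholesky)
    then have "det M \<noteq> 0" using detX[OF i] by (auto simp: det_transpose_mult_self)
    with M(1) obtain P where P: "P \<in> carrier_mat (d i) (d i)" "M * P = 1\<^sub>m (d i)" "P * M = 1\<^sub>m (d i)"
      by (rule det_nonzero_inverse)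
    have T: "transpose_mat P \<in> carrier_mat (d i) (d i)" "transpose_mat M \<in> carrier_mat (d i) (d i)"
      using P M by auto
    have "transpose_mat P * X i * P = transpose_mat P * (X i * P)"
      using T P M by (intro assoc_mult_mat) auto
    also have "X i * P = transpose_mat M"
      using assoc_mult_mat[OF T(2) M(1) P(1)] T P(2) M(2) by simp
    also have "transpose_mat P * transpose_mat M = 1\<^sub>m (d i)"
      using transpose_mult[OF M(1) P(1)] P(2) by simp
    finally show ?thesis using P M by blast
  qed
  then obtain P P' where P: "\<And>i. i \<in> {1..k} \<Longrightarrow> P i \<in> carrier_mat (d i) (d i)"
    "\<And>i. i \<in> {1..k} \<Longrightarrow> P' i \<in> carrier_mat (d i) (d i)"
    "\<And>i. i \<in> {1..k} \<Longrightarrow> P i * P' i = 1\<^sub>m (d i)"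
    "\<And>i. i \<in> {1..k} \<Longrightarrow> P' i * P i = 1\<^sub>m (d i)"
    "\<And>i. i \<in> {1..k} \<Longrightarrow> transpose_mat (P i) * X i * P i = 1\<^sub>m (d i)"
    by metis
  have det_congr: "det (transpose_mat (P i) * Z * P i) = det Z * (det (P i))\<^sup>2"
    if "i \<in> {1..k}" "Z \<in> carrier_mat (d i) (d i)" for i Z
    using P(1)[OF that(1)] that(2)
    by (simp add: det_mult[of _ "d i"] det_transpose power2_eq_square)
  have "det (X i) * (det (P i))\<^sup>2 = 1" if "i \<in> {1..k}" for i
    using det_congr[OF that, of "X i"] left_gram_carrier[OF NV that] P(5)[OF that] by (simp add: X_def)
  then have XP: "(\<Prod>i\<in>{1..k}. det (X i)) * (\<Prod>i\<in>{1..k}. (det (P i))\<^sup>2) = 1"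
    by (simp add: prod.distrib[symmetric])
  have minimal: "exp (- \<tau>) * (\<Prod>j\<in>{1..m}. (det (E j))\<^sup>2 powr p j) \<le>
      (\<Prod>i\<in>{1..k}. det (left_gram m d p A (\<lambda>i j a. E j * (N j * V a * P i)) i))"
    if E: "\<And>j. j \<in> {1..m} \<Longrightarrow> E j \<in> carrier_mat (n j) (n j) \<and> det (E j) \<noteq> 0" for E
  proof -
    define Z where "Z = left_gram m d p A (\<lambda>i j a. E j * N j * V a)"
    have EN: "E j * N j \<in> carrier_mat (n j) (n j)" "det (E j * N j) = det (E j) * det (N j)"
      if "j \<in> {1..m}" for j
      using E[OF that] N(1)[OF that] by (auto simp: det_mult[of _ "n j"])
    have ENV: "arrows_fit k m d n p A (\<lambda>i j a. E j * N j * V a)"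
      using V EN(1) by (rule arrows_fit_mult_left)
    have "C \<le> capacity_ratio k m d p A V (\<lambda>j. transpose_mat (E j * N j) * (E j * N j))"
      unfolding C_def
    proof (intro capacity_le_ratio V)
      fix j assume j: "j \<in> {1..m}"
      have "det (E j * N j) \<noteq> 0" using EN(2)[OF j] E[OF j] N(3)[OF j] by simp
      then show "transpose_mat (E j * N j) * (E j * N j) \<in> pos_def_mats (n j)"
        using EN(1)[OF j] unfolding pos_def_mats_iff_gram by blast
    qed
    also have "\<dots> = (\<Prod>i\<in>{1..k}. det (Z i)) / (\<Prod>j\<in>{1..m}. (det (E j * N j))\<^sup>2 powr p j)"
      unfolding Z_def by (intro capacity_ratio_gram[OF V] EN) auto
    also have "(\<Prod>j\<in>{1..m}. (det (E j * N j))\<^sup>2 powr p j) =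
        (\<Prod>j\<in>{1..m}. (det (E j))\<^sup>2 powr p j) * (\<Prod>j\<in>{1..m}. (det (N j))\<^sup>2 powr p j)"
      using EN(2) by (simp add: power_mult_distrib powr_mult prod.distrib)
    finally have CZ: "C \<le> (\<Prod>i\<in>{1..k}. det (Z i)) /
        ((\<Prod>j\<in>{1..m}. (det (E j))\<^sup>2 powr p j) * (\<Prod>j\<in>{1..m}. (det (N j))\<^sup>2 powr p j))" .
    have "left_gram m d p A (\<lambda>i j a. E j * (N j * V a * P i)) i = transpose_mat (P i) * Z i * P i"
      if i: "i \<in> {1..k}" for i
    proof -
      have "left_gram m d p A (\<lambda>i j a. E j * (N j * V a * P i)) i = left_gram m d p A (\<lambda>i j a. E j * N j * V a * P i) i"
      proof (rule left_gram_cong)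
        show "arrows_fit k m d n p A (\<lambda>i j a. E j * N j * V a * P i)"
          using ENV P(1) by (rule arrows_fit_mult_right)
        fix j a assume ja: "j \<in> {1..m}" "a \<in> A i j"
        have Va: "V a \<in> carrier_mat (n j) (d i)" using V i ja by (rule arrows_fitD)
        have "E j * (N j * V a * P i) = E j * (N j * V a) * P i"
          using E[OF ja(1)] N(1)[OF ja(1)] Va P(1)[OF i] by (intro assoc_mult_mat[symmetric]) auto
        also have "E j * (N j * V a) = E j * N j * V a"
          using E[OF ja(1)] N(1)[OF ja(1)] Va by (intro assoc_mult_mat[symmetric]) auto
        finally show "E j * (N j * V a * P i) = E j * N j * V a * P i" .
      qed (rule i)
      then show ?thesis unfolding Z_def using left_gram_mult_right[OF ENV i] P(1)[OF i] by simp
    qed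
    then have ZP: "(\<Prod>i\<in>{1..k}. det (left_gram m d p A (\<lambda>i j a. E j * (N j * V a * P i)) i)) =
        (\<Prod>i\<in>{1..k}. det (Z i)) * (\<Prod>i\<in>{1..k}. (det (P i))\<^sup>2)"
      using left_gram_carrier[OF ENV] by (simp add: det_congr Z_def prod.distrib)
    define x y z e \<nu> where "x = (\<Prod>i\<in>{1..k}. det (X i))" and "y = (\<Prod>i\<in>{1..k}. (det (P i))\<^sup>2)"
      and "z = (\<Prod>i\<in>{1..k}. det (Z i))" and "e = (\<Prod>j\<in>{1..m}. (det (E j))\<^sup>2 powr p j)"
      and "\<nu> = (\<Prod>j\<in>{1..m}. (det (N j))\<^sup>2 powr p j)"
    have "0 < e" "0 < \<nu>" using E N(3) by (auto simp: e_def \<nu>_def intro!: prod_pos)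
    have "0 \<le> y" by (auto simp: y_def intro!: prod_nonneg)
    have xy: "x * y = 1" using XP by (simp add: x_def y_def)
    have "x / \<nu> < C * exp \<tau>" using Y(2) unfolding ratio x_def \<nu>_def .
    then have "exp (- \<tau>) * (x / \<nu>) \<le> exp (- \<tau>) * (C * exp \<tau>)" by (intro mult_left_mono) auto
    also have "\<dots> = C" by (simp add: exp_minus)
    also have "\<dots> \<le> z / (e * \<nu>)" using CZ unfolding z_def e_def \<nu>_def .
    finally have "exp (- \<tau>) * e * x \<le> z"
      using \<open>0 < e\<close> \<open>0 < \<nu>\<close> by (simp add: field_simps)
    then have "exp (- \<tau>) * e * x * y \<le> z * y" using \<open>0 \<le> y\<close> by (rule mult_right_mono)
    then show ?thesis using xy ZP by (simp add: mult.assoc x_def y_def z_def e_def)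
  qed
  have "left_gram m d p A (\<lambda>i j a. N j * V a * P i) i = 1\<^sub>m (d i)" if "i \<in> {1..k}" for i
    using left_gram_mult_right[OF NV that] P(1,5)[OF that] by (simp add: X_def)
  moreover have "almost_minimal k m d n p A \<tau> (\<lambda>i j a. N j * V a * P i)"
    unfolding almost_minimal_def using minimal by blast
  ultimately show ?thesis by (intro that[of N P P'] N P) auto
qed

section \<open>Near-minimality forces the right Gram matrices close to the identity\<close>

text \<open>Perturb the block \<open>j\<close> only. The product of the determinants of the left Gram matrices, which
  starts at \<open>1\<close>, becomes at most the exponential of the change of their total trace, by the bound on
  determinants of positive semidefinite matrices. The weighted total trace of the right Gram
  matrices changes by the same amount, and only block \<open>j\<close> contributes to the change.\<close>

lemma trace_block_bound:
  assumes U: "arrows_fit k m d n p A U" and one: "\<And>i. i \<in> {1..k} \<Longrightarrow> left_gram m d p A U i = 1\<^sub>m (d i)"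
    and min: "almost_minimal k m d n p A \<tau> U"
    and j: "j \<in> {1..m}" and F: "F \<in> carrier_mat (n j) (n j)" "det F \<noteq> 0"
  shows "p j * ln ((det F)\<^sup>2) - \<tau> \<le>
    p j * (\<Sum>r<n j. right_gram k n A (\<lambda>i j a. F * U i j a) j $$ (r, r) - right_gram k n A U j $$ (r, r))"
proof -
  define E where "E = (\<lambda>l. if l = j then F else 1\<^sub>m (n l))"
  define EU where "EU = (\<lambda>i l a. E l * U i l a)"
  have E: "E l \<in> carrier_mat (n l) (n l)" "det (E l) \<noteq> 0" for l using F by (auto simp: E_def)
  have EU: "arrows_fit k m d n p A EU" unfolding EU_def using U E(1) by (rule arrows_fit_mult_left)
  have same: "right_gram k n A EU l $$ (r, r) = right_gram k n A U l $$ (r, r)" if "l \<in> {1..m}" "l \<noteq> j" "r < n l" for l r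
  proof -
    have "EU i l a = U i l a" if "i \<in> {1..k}" "a \<in> A i l" for i a
      using arrows_fitD[OF U that(1) \<open>l \<in> {1..m}\<close> that(2)] \<open>l \<noteq> j\<close> by (simp add: EU_def E_def)
    then show ?thesis
      using that by (simp add: right_gram_carrier_entry(2)[OF EU] right_gram_carrier_entry(2)[OF U])
  qed
  have "right_gram k n A EU j = right_gram k n A (\<lambda>i j a. F * U i j a) j"
    by (simp add: right_gram_def EU_def E_def)
  define \<Delta> where "\<Delta> = (\<Sum>r<n j. right_gram k n A EU j $$ (r, r) - right_gram k n A U j $$ (r, r))"
  have prod_E: "(\<Prod>l\<in>{1..m}. (det (E l))\<^sup>2 powr p l) = (det F)\<^sup>2 powr p j"
  proof -
    have "(\<Prod>l\<in>{1..m}. (det (E l))\<^sup>2 powr p l) = (\<Prod>l\<in>{1..m}. if l = j then (det F)\<^sup>2 powr p j else 1)"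
      by (intro prod.cong) (auto simp: E_def)
    then show ?thesis using j by simp
  qed
  have "(\<Prod>i\<in>{1..k}. det (left_gram m d p A EU i)) \<le>
      (\<Prod>i\<in>{1..k}. exp ((\<Sum>r<d i. left_gram m d p A EU i $$ (r, r)) - real (d i)))"
    using left_gram_psd[OF EU]
    by (intro prod_mono) (auto intro: pos_semidef_mat_det_nonneg pos_semidef_mat_det_le_exp_trace)
  also have "\<dots> = exp ((\<Sum>i\<in>{1..k}. \<Sum>r<d i. left_gram m d p A EU i $$ (r, r)) -
      (\<Sum>i\<in>{1..k}. \<Sum>r<d i. left_gram m d p A U i $$ (r, r)))"
    by (simp add: exp_sum[symmetric] sum_subtractf one)
  also have "(\<Sum>i\<in>{1..k}. \<Sum>r<d i. left_gram m d p A EU i $$ (r, r)) -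
      (\<Sum>i\<in>{1..k}. \<Sum>r<d i. left_gram m d p A U i $$ (r, r)) =
      (\<Sum>l\<in>{1..m}. p l * (\<Sum>r<n l. right_gram k n A EU l $$ (r, r) - right_gram k n A U l $$ (r, r)))"
    unfolding trace_left_gram_eq_trace_right_gram[OF EU] trace_left_gram_eq_trace_right_gram[OF U]
    by (simp add: sum_subtractf right_diff_distrib)
  also have "\<dots> = (\<Sum>l\<in>{1..m}. if l = j then p j * \<Delta> else 0)"
    by (intro sum.cong) (auto simp: same \<Delta>_def)
  also have "\<dots> = p j * \<Delta>" using j by simp
  finally have upper: "(\<Prod>i\<in>{1..k}. det (left_gram m d p A EU i)) \<le> exp (p j * \<Delta>)" .
  have "exp (p j * ln ((det F)\<^sup>2) - \<tau>) = exp (- \<tau>) * (det F)\<^sup>2 powr p j"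
    using F(2) by (simp add: powr_def exp_diff exp_minus field_simps)
  also have "\<dots> \<le> exp (p j * \<Delta>)"
    using min[unfolded almost_minimal_def, rule_format, of E] E upper
    unfolding prod_E EU_def[symmetric] by auto
  finally show ?thesis
    unfolding \<Delta>_def \<open>right_gram k n A EU j = _\<close> by simp
qed

text \<open>Row operations serve as test perturbations: their determinants are known, and they change a
  single diagonal entry of the right Gram matrix.\<close>

lemma right_gram_multrow:
  assumes U: "arrows_fit k m d n p A U" and j: "j \<in> {1..m}" and r: "r < n j"
  shows "right_gram k n A (\<lambda>i j' a. multrow_mat (n j) s c * U i j' a) j $$ (r, r) =
    (if r = s then c\<^sup>2 else 1) * right_gram k n A U j $$ (r, r)"
proof -
  let ?F = "multrow_mat (n j) s c"
  let ?U = "\<lambda>i j' a. if j' = j then ?F * U i j' a else U i j' a"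
  have fit: "arrows_fit k m d n p A ?U"
    using U by (auto simp: arrows_fit_def intro!: mult_carrier_mat[of _ "n j" "n j"])
  have F: "(?F * U i j a) $$ (r, l) = (if r = s then c else 1) * U i j a $$ (r, l)"
    if "i \<in> {1..k}" "a \<in> A i j" "l < d i" for i a l
  proof -
    note Ua = arrows_fitD[OF U that(1) j that(2)]
    show ?thesis
      unfolding multrow_mat[OF Ua, symmetric] using carrier_matD[OF Ua] r that(3) by simp
  qed
  have "right_gram k n A (\<lambda>i j' a. ?F * U i j' a) j $$ (r, r) = right_gram k n A ?U j $$ (r, r)"
    by (simp add: right_gram_def)
  also have "\<dots> = (\<Sum>i\<in>{1..k}. \<Sum>a\<in>A i j. \<Sum>l<d i.
      (if r = s then c\<^sup>2 else 1) * (U i j a $$ (r, l) * U i j a $$ (r, l)))"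
    unfolding right_gram_carrier_entry(2)[OF fit j r r]
    by (intro sum.cong refl) (simp add: F power2_eq_square)
  finally show ?thesis
    by (simp add: right_gram_carrier_entry(2)[OF U j r r] sum_distrib_left)
qed

lemma right_gram_addrow:
  assumes U: "arrows_fit k m d n p A U" and j: "j \<in> {1..m}" and r: "r < n j" and t: "t < n j"
  shows "right_gram k n A (\<lambda>i j' a. addrow_mat (n j) c s t * U i j' a) j $$ (r, r) =
    right_gram k n A U j $$ (r, r) +
    (if r = s then 2 * c * right_gram k n A U j $$ (s, t) + c\<^sup>2 * right_gram k n A U j $$ (t, t) else 0)"
proof -
  let ?F = "addrow_mat (n j) c s t"
  let ?U = "\<lambda>i j' a. if j' = j then ?F * U i j' a else U i j' a"
  have fit: "arrows_fit k m d n p A ?U"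
    using U by (auto simp: arrows_fit_def intro!: mult_carrier_mat[of _ "n j" "n j"])
  have F: "(?F * U i j a) $$ (r, l) = U i j a $$ (r, l) + (if r = s then c * U i j a $$ (t, l) else 0)"
    if "i \<in> {1..k}" "a \<in> A i j" "l < d i" for i a l
  proof -
    note Ua = arrows_fitD[OF U that(1) j that(2)]
    show ?thesis
      unfolding addrow_mat[OF Ua t, symmetric] using carrier_matD[OF Ua] r t that(3) by simp
  qed
  have "right_gram k n A (\<lambda>i j' a. ?F * U i j' a) j $$ (r, r) = right_gram k n A ?U j $$ (r, r)"
    by (simp add: right_gram_def)
  also have "\<dots> = (\<Sum>i\<in>{1..k}. \<Sum>a\<in>A i j. \<Sum>l<d i. U i j a $$ (r, l) * U i j a $$ (r, l) +
      (if r = s then 2 * c * (U i j a $$ (s, l) * U i j a $$ (t, l)) +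
        c\<^sup>2 * (U i j a $$ (t, l) * U i j a $$ (t, l)) else 0))"
    unfolding right_gram_carrier_entry(2)[OF fit j r r]
    by (intro sum.cong refl) (simp add: F power2_eq_square algebra_simps)
  finally show ?thesis
    using r by (auto simp: right_gram_carrier_entry(2)[OF U j] t sum_distrib_left sum.distrib)
qed

text \<open>Let \<open>W\<close> be the right Gram matrix \<open>j\<close>. Rescaling row \<open>t\<close> by \<open>sqrt u\<close> tests the diagonal entry
  \<open>W\<^sub>t\<^sub>t\<close>. Adding \<open>c\<close> times row \<open>t\<close> to row \<open>s\<close> has determinant \<open>1\<close>, so the diagonal entry \<open>W\<^sub>s\<^sub>s + 2 c W\<^sub>s\<^sub>t + c\<^sup>2 W\<^sub>t\<^sub>t\<close> that it creates cannot be much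
  below \<open>W\<^sub>s\<^sub>s\<close> for any \<open>c\<close>, which makes \<open>W\<^sub>s\<^sub>t\<close> small.\<close>

lemma right_gram_near_one:
  assumes U: "arrows_fit k m d n p A U" and one: "\<And>i. i \<in> {1..k} \<Longrightarrow> left_gram m d p A U i = 1\<^sub>m (d i)"
    and min: "almost_minimal k m d n p A \<tau> U"
    and h: "0 < h" "h \<le> 1 / 3" and j: "j \<in> {1..m}" and \<tau>: "\<tau> \<le> p j * h\<^sup>2"
    and s: "s < n j" and t: "t < n j"
  shows "\<bar>(right_gram k n A U j - 1\<^sub>m (n j)) $$ (s, t)\<bar> \<le> 3 * h"
proof -
  let ?W = "right_gram k n A U j"
  note test = trace_block_bound[OF U one min j]
  have W: "?W \<in> carrier_mat (n j) (n j)" using right_gram_carrier_entry(1)[OF U j] .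
  have diag: "\<bar>?W $$ (t, t) - 1\<bar> \<le> 3 * h" if t: "t < n j" for t
  proof (rule near_one_of_log_bound[OF h])
    fix u :: real assume u: "0 < u"
    let ?F = "multrow_mat (n j) t (sqrt u)"
    have "p j * ln u - \<tau> \<le>
        p j * (\<Sum>r<n j. right_gram k n A (\<lambda>i j a. ?F * U i j a) j $$ (r, r) - ?W $$ (r, r))"
      using test[of ?F] u t by (simp add: det_multrow_mat)
    also have "(\<Sum>r<n j. right_gram k n A (\<lambda>i j a. ?F * U i j a) j $$ (r, r) - ?W $$ (r, r)) =
        (\<Sum>r<n j. if r = t then (u - 1) * ?W $$ (t, t) else 0)"
      using u by (intro sum.cong refl) (simp add: right_gram_multrow[OF U j] left_diff_distrib)
    also have "\<dots> = (u - 1) * ?W $$ (t, t)" using t by simp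
    finally have "p j * (ln u - h\<^sup>2) \<le> p j * ((u - 1) * ?W $$ (t, t))"
      using \<tau> by (simp add: right_diff_distrib)
    then show "ln u - h\<^sup>2 \<le> (u - 1) * ?W $$ (t, t)" using arrows_fit_weight_pos[OF U j] by simp
  qed
  show ?thesis
  proof (cases "s = t")
    case True
    then show ?thesis using diag[OF t] t W by simp
  next
    case False
    have "\<bar>?W $$ (s, t)\<bar> \<le> 3 * h"
    proof (rule near_zero_of_quadratic_bound[OF h(1)])
      show "?W $$ (t, t) \<le> 2" using diag[OF t] h(2) by linarith
      fix c :: real
      let ?F = "addrow_mat (n j) c s t"
      have "- \<tau> \<le> p j * (\<Sum>r<n j. right_gram k n A (\<lambda>i j a. ?F * U i j a) j $$ (r, r) - ?W $$ (r, r))"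
        using test[of ?F] False by (simp add: det_addrow_mat)
      also have "(\<Sum>r<n j. right_gram k n A (\<lambda>i j a. ?F * U i j a) j $$ (r, r) - ?W $$ (r, r)) =
          (\<Sum>r<n j. if r = s then 2 * c * ?W $$ (s, t) + c\<^sup>2 * ?W $$ (t, t) else 0)"
        by (intro sum.cong refl) (simp add: right_gram_addrow[OF U j _ t])
      also have "\<dots> = 2 * c * ?W $$ (s, t) + c\<^sup>2 * ?W $$ (t, t)" using s by simp
      finally have "p j * (- h\<^sup>2) \<le> p j * (2 * c * ?W $$ (s, t) + c\<^sup>2 * ?W $$ (t, t))"
        using \<tau> by linarith
      then show "- h\<^sup>2 \<le> 2 * c * ?W $$ (s, t) + c\<^sup>2 * ?W $$ (t, t)"
        using arrows_fit_weight_pos[OF U j] by (simp only: mult_le_cancel_left_pos)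
    qed
    then show ?thesis using False s t W by simp
  qed
qed

text \<open>The estimate for entries is linear in \<open>h\<close>, so \<open>h\<close> is a third of the target accuracy, and the
  smallest weight makes one \<open>\<tau>\<close> fine enough for every block.\<close>

lemma scaling_with_small_entries:
  assumes V: "arrows_fit k m d n p A (\<lambda>i j a. V a)" and feas: "feasible k m d n p A V"
    and m: "0 < m" and \<eta>: "0 < \<eta>"
  obtains N P P' where
    "\<And>j. j \<in> {1..m} \<Longrightarrow> N j \<in> carrier_mat (n j) (n j)"
    "\<And>j. j \<in> {1..m} \<Longrightarrow> det (N j) \<noteq> 0"
    "\<And>i. i \<in> {1..k} \<Longrightarrow> P i \<in> carrier_mat (d i) (d i)"
    "\<And>i. i \<in> {1..k} \<Longrightarrow> P' i \<in> carrier_mat (d i) (d i)"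
    "\<And>i. i \<in> {1..k} \<Longrightarrow> P i * P' i = 1\<^sub>m (d i)"
    "\<And>i. i \<in> {1..k} \<Longrightarrow> P' i * P i = 1\<^sub>m (d i)"
    "arrows_fit k m d n p A (\<lambda>i j a. N j * V a * P i)"
    "\<And>i. i \<in> {1..k} \<Longrightarrow> left_gram m d p A (\<lambda>i j a. N j * V a * P i) i = 1\<^sub>m (d i)"
    "\<And>j s t. j \<in> {1..m} \<Longrightarrow> s < n j \<Longrightarrow> t < n j \<Longrightarrow>
      \<bar>(right_gram k n A (\<lambda>i j a. N j * V a * P i) j - 1\<^sub>m (n j)) $$ (s, t)\<bar> \<le> \<eta>"
proof -
  define h where "h = min (1 / 3) (\<eta> / 3)"
  have h: "0 < h" "h \<le> 1 / 3" "3 * h \<le> \<eta>" using \<eta> by (simp_all add: h_def)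
  define \<tau> where "\<tau> = Min (p ` {1..m}) * h\<^sup>2"
  have "p ` {1..m} \<noteq> {}" using m by auto
  then have "0 < Min (p ` {1..m})" using arrows_fit_weight_pos[OF V] by (subst Min_gr_iff) auto
  then have \<tau>: "0 < \<tau>" using h by (simp add: \<tau>_def)
  have \<tau>_le: "\<tau> \<le> p j * h\<^sup>2" if "j \<in> {1..m}" for j
    unfolding \<tau>_def using that by (intro mult_right_mono Min_le) auto
  obtain N P P' where
    N: "\<And>j. j \<in> {1..m} \<Longrightarrow> N j \<in> carrier_mat (n j) (n j)" "\<And>j. j \<in> {1..m} \<Longrightarrow> det (N j) \<noteq> 0"
    and P: "\<And>i. i \<in> {1..k} \<Longrightarrow> P i \<in> carrier_mat (d i) (d i)"
    "\<And>i. i \<in> {1..k} \<Longrightarrow> P' i \<in> carrier_mat (d i) (d i)"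
    "\<And>i. i \<in> {1..k} \<Longrightarrow> P i * P' i = 1\<^sub>m (d i)" "\<And>i. i \<in> {1..k} \<Longrightarrow> P' i * P i = 1\<^sub>m (d i)"
    and one: "\<And>i. i \<in> {1..k} \<Longrightarrow> left_gram m d p A (\<lambda>i j a. N j * V a * P i) i = 1\<^sub>m (d i)"
    and min: "almost_minimal k m d n p A \<tau> (\<lambda>i j a. N j * V a * P i)"
    using near_minimiser[OF V feas \<tau>] by blast
  have U: "arrows_fit k m d n p A (\<lambda>i j a. N j * V a * P i)"
    by (intro arrows_fit_mult_right arrows_fit_mult_left V N P)
  have "\<bar>(right_gram k n A (\<lambda>i j a. N j * V a * P i) j - 1\<^sub>m (n j)) $$ (s, t)\<bar> \<le> \<eta>"
    if "j \<in> {1..m}" "s < n j" "t < n j" for j s t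
    using right_gram_near_one[OF U one min h(1,2) that(1) \<tau>_le[OF that(1)] that(2,3)] h(3)
    by linarith
  then show ?thesis by (intro that[of N P P'] N P U one) auto
qed

section \<open>Scaling\<close>

theorem theorem1p10:
  fixes k m :: nat
    and d n :: "nat \<Rightarrow> nat"
    and p :: "nat \<Rightarrow> real"
    and A :: "nat \<Rightarrow> nat \<Rightarrow> 'a set"
    and V :: "'a \<Rightarrow> real mat"
    and nrm :: "real mat \<Rightarrow> real"
    and \<epsilon> :: real
  assumes "quiver_datum k m d n p A V"
    and "feasible k m d n p A V"
    and "\<And>j. j \<in> {1..m} \<Longrightarrow> matrix_norm_on (n j) nrm"
    and "\<epsilon> > 0"
  shows "\<exists>V' :: 'a \<Rightarrow> real mat.
    equivalent_tuples k m d n A V V' \<and>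
    (\<forall>i\<in>{1..k}.
      finsum_mat (d i) (d i)
        (\<lambda>j. p j \<cdot>\<^sub>m finsum_mat (d i) (d i) (\<lambda>a. transpose_mat (V' a) * V' a) (A i j)) {1..m}
      = 1\<^sub>m (d i)) \<and>
    (\<forall>j\<in>{1..m}.
      nrm (finsum_mat (n j) (n j)
        (\<lambda>i. finsum_mat (n j) (n j) (\<lambda>a. V' a * transpose_mat (V' a)) (A i j)) {1..k}
      - 1\<^sub>m (n j)) < \<epsilon>)"
proof -
  note datum = assms(1)[unfolded quiver_datum_def]
  have m: "0 < m" using datum by blast
  let ?fit = "arrows_fit k m d n p A" and ?left = "left_gram m d p A" and ?right = "right_gram k n A"
  have V: "?fit (\<lambda>i j a. V a)"
    using datum by (simp add: arrows_fit_def)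
  have "\<forall>j\<in>{1..m}. \<exists>K\<ge>0. \<forall>B \<in> carrier_mat (n j) (n j). \<forall>\<eta>.
      (\<forall>s<n j. \<forall>t<n j. \<bar>B $$ (s, t)\<bar> \<le> \<eta>) \<longrightarrow> nrm B \<le> K * \<eta>"
    using assms(3) matrix_norm_on_entry_bound by blast
  then obtain K where K: "\<And>j. j \<in> {1..m} \<Longrightarrow> 0 \<le> K j"
    "\<And>j B \<eta>. j \<in> {1..m} \<Longrightarrow> B \<in> carrier_mat (n j) (n j) \<Longrightarrow>
      (\<And>s t. s < n j \<Longrightarrow> t < n j \<Longrightarrow> \<bar>B $$ (s, t)\<bar> \<le> \<eta>) \<Longrightarrow> nrm B \<le> K j * \<eta>"
    by metis
  define S where "S = (\<Sum>j\<in>{1..m}. K j)"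
  have S: "0 \<le> S" using K(1) by (auto simp: S_def intro: sum_nonneg)
  define \<eta> where "\<eta> = \<epsilon> / (S + 1)"
  have \<eta>: "0 < \<eta>" using assms(4) S by (simp add: \<eta>_def)
  have small: "K j * \<eta> < \<epsilon>" if "j \<in> {1..m}" for j
  proof -
    have "K j \<le> S" unfolding S_def using that K(1) by (intro member_le_sum) auto
    then have "K j * \<eta> < (S + 1) * \<eta>" using \<eta> by (intro mult_strict_right_mono) auto
    also have "\<dots> = \<epsilon>" using S by (simp add: \<eta>_def)
    finally show ?thesis .
  qed
  obtain N P P' where
    N: "\<And>j. j \<in> {1..m} \<Longrightarrow> N j \<in> carrier_mat (n j) (n j)" "\<And>j. j \<in> {1..m} \<Longrightarrow> det (N j) \<noteq> 0"
    and P: "\<And>i. i \<in> {1..k} \<Longrightarrow> P i \<in> carrier_mat (d i) (d i)"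
    "\<And>i. i \<in> {1..k} \<Longrightarrow> P' i \<in> carrier_mat (d i) (d i)"
    "\<And>i. i \<in> {1..k} \<Longrightarrow> P i * P' i = 1\<^sub>m (d i)" "\<And>i. i \<in> {1..k} \<Longrightarrow> P' i * P i = 1\<^sub>m (d i)"
    and U: "?fit (\<lambda>i j a. N j * V a * P i)"
    and one: "\<And>i. i \<in> {1..k} \<Longrightarrow> ?left (\<lambda>i j a. N j * V a * P i) i = 1\<^sub>m (d i)"
    and near: "\<And>j s t. j \<in> {1..m} \<Longrightarrow> s < n j \<Longrightarrow> t < n j \<Longrightarrow>
      \<bar>(?right (\<lambda>i j a. N j * V a * P i) j - 1\<^sub>m (n j)) $$ (s, t)\<bar> \<le> \<eta>"
    using scaling_with_small_entries[OF V assms(2) m \<eta>] by blast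
  \<comment> \<open>The arrow sets are disjoint, so each arrow recovers its pair of vertices.\<close>
  define idx where "idx a = (SOME x. x \<in> {1..k} \<times> {1..m} \<and> a \<in> A (fst x) (snd x))" for a
  have idx: "idx a = (i, j)" if "i \<in> {1..k}" "j \<in> {1..m}" "a \<in> A i j" for a i j
  proof -
    have "idx a \<in> {1..k} \<times> {1..m} \<and> a \<in> A (fst (idx a)) (snd (idx a))"
      unfolding idx_def by (rule someI[of _ "(i, j)"]) (use that in auto)
    moreover have "disjoint_family_on (\<lambda>(i, j). A i j) ({1..k} \<times> {1..m})" using datum by blast
    ultimately show ?thesis
      using that unfolding disjoint_family_on_def by (fastforce simp: case_prod_beta)
  qed
  define U where "U = (\<lambda>i j a. N j * V a * P i)"
  note U = U[folded U_def] and one = one[folded U_def] and near = near[folded U_def]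
  define V' where "V' a = U (fst (idx a)) (snd (idx a)) a" for a
  have V': "V' a = U i j a" if "i \<in> {1..k}" "j \<in> {1..m}" "a \<in> A i j" for a i j
    using idx[OF that] by (simp add: V'_def)
  have "equivalent_tuples k m d n A V V'"
    unfolding equivalent_tuples_def
  proof (rule exI[of _ P'], rule exI[of _ P], rule exI[of _ N], intro conjI ballI)
    fix j assume j: "j \<in> {1..m}"
    obtain N' where N': "N' \<in> carrier_mat (n j) (n j)" "N j * N' = 1\<^sub>m (n j)" "N' * N j = 1\<^sub>m (n j)"
      using N[OF j] by (rule det_nonzero_inverse)
    show "invertible_mat (N j)"
      using N(1)[OF j] N' by (auto simp: invertible_mat_def inverts_mat_def intro!: exI[of _ N'])
  qed (use N P V' carrier_matD(1)[OF P(1)] carrier_matD(1)[OF P(2)] in \<open>auto simp: inverts_mat_def U_def\<close>)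
  moreover have "?left (\<lambda>i j a. V' a) i = 1\<^sub>m (d i)" if i: "i \<in> {1..k}" for i
  proof -
    have "?left (\<lambda>i j a. V' a) i = ?left U i"
      using V'[OF i] U i by (rule left_gram_cong)
    then show ?thesis using one[OF i] by simp
  qed
  moreover have "nrm (?right (\<lambda>i j a. V' a) j - 1\<^sub>m (n j)) < \<epsilon>" if j: "j \<in> {1..m}" for j
  proof -
    have "?right (\<lambda>i j a. V' a) j = ?right U j"
      using V'[OF _ j] U j by (rule right_gram_cong)
    moreover have "nrm (?right U j - 1\<^sub>m (n j)) \<le> K j * \<eta>"
    proof (rule K(2)[OF j])
      show "?right U j - 1\<^sub>m (n j) \<in> carrier_mat (n j) (n j)"
        using U j by (intro minus_carrier_mat right_gram_carrier_entry(1)) auto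
      show "\<bar>(?right U j - 1\<^sub>m (n j)) $$ (s, t)\<bar> \<le> \<eta>" if "s < n j" "t < n j" for s t
        using near[OF j that] .
    qed
    ultimately show ?thesis using small[OF j] by simp
  qed
  ultimately show ?thesis
    unfolding left_gram_def right_gram_def by blast
qed

end
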